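(* Let $\mathcal{G}$ be a countable projective Fraïssé family in a language $L_0$, let $\mathbb{P}$ be the projective Fraïssé limit of $\mathcal{G}$, and let $H$ be a closed subspace of $\mathrm{Aut}(\mathbb{P})$ that is invariant under conjugation by elements of $\mathrm{Aut}(\mathbb{P})$. Let $$\mathcal{F}=\{(A,s^A)\colon A\in\mathcal{G}\text{ and there are an epimorphism }\phi\colon\mathbb{P}\to A\text{ and } f\in H\text{ such that }\phi\colon(\mathbb{P},f)\to(A,s^A)\text{ is an epimorphism}\}.$$ Then $\mathcal{F}$ has the joint projection property (JPP) if and only if the conjugation action of $\mathrm{Aut}(\mathbb{P})$ on $H$ has a dense orbit.
   Context: Given a language $L$ of relation symbols and function symbols, a topological $L$-structure is a compact zero-dimensional second-countable space $A$ equipped with closed relations $q^A$ and continuous functions $f^A$ interpreting the symbols. An epimorphism $\phi\colon B\to A$ is a continuous surjection such that for each function symbol $f$ of arity $n$ and $x_1,\dots,x_n\in B$, $f^A(\phi(x_1),\dots,\phi(x_n))=\phi(f^B(x_1,\dots,x_n))$, and for each relation symbol $q$ of arity $m$ and $x_1,\dots,x_m\in A$, $q^A(x_1,\dots,x_m)$ holds iff there are $y_1,\dots,y_m\in B$ with $\phi(y_i)=x_i$ for all $i$ and $q^B(y_1,\dots,y_m)$. An isomorphism is a bijective epimorphism. A family of finite topological $L$-structures has the JPP if for any $A,B$ in it there are $C$ in it and epimorphisms from $C$ onto $A$ and from $C$ onto $B$. It has the AP if for any $A,B_1,B_2$ in it and epimorphisms $\phi_1\colon B_1\to A$, $\phi_2\colon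 B_2\to A$, there are $C$ in it and epimorphisms $\phi_3\colon C\to B_1$, $\phi_4\colon C\to B_2$ with $\phi_1\circ\phi_3=\phi_2\circ\phi_4$. A projective Fraïssé family is a family of finite topological structures having the JPP and the AP. A projective Fraïssé limit of $\mathcal{G}$ (it exists and is unique up to isomorphism for countable $\mathcal G$) is a topological $L_0$-structure $\mathbb{P}$ such that (L1) for every $A\in\mathcal{G}$ there is an epimorphism $\mathbb{P}\to A$; (L2) for every finite discrete space $X$ and continuous $f\colon\mathbb{P}\to X$ there are $A\in\mathcal{G}$, an epimorphism $\phi\colon\mathbb{P}\to A$ and a function $f_0\colon A\to X$ with $f=f_0\circ\phi$; (L3) for every $A\in\mathcal{G}$ and epimorphisms $\phi_1,\phi_2\colon\mathbb{P}\to A$ there is an isomorphism $\psi\colon\mathbb{P}\to\mathbb{P}$ with $\phi_2=\phi_1\circ\psi$. $\mathrm{Aut}(\mathbb{P})$ is the group of isomorphisms $\mathbb{P}\to\mathbb{P}$, with the topology inherited from the homeomorphism group of $\mathbb{P}$ with the compact-open topology. It acts on itself by conjugation $h\mapsto ghg^{-1}$, and $H$ carries the subspace topology. Let $s$ be a binary relation symbol not in $L_0$. Structures $(A,s^A)$, with $A$ a topological $L_0$-structure and $s^A$ a binary relation on $A$, are viewed as $L_0\cup\{s\}$-structures. For $f\in\mathrm{Aut}(\mathbb{P})$, $(\mathbb{P},f)$ denotes the $L_0\cup\{s\}$-structure in which $s^{\mathbb{P}}(x,y)$ iff $f(x)=y$. The JPP for $\mathcal{F}$ is with respect to epimorphisms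 of $L_0\cup\{s\}$-structures. *)

theory Defs
  imports "HOL-Analysis.Analysis" "HOL-Algebra.Group_Action"
begin

record ('f, 'r) language =
  fun_syms :: "'f set"
  rel_syms :: "'r set"
  fun_arity :: "'f \<Rightarrow> nat"
  rel_arity :: "'r \<Rightarrow> nat"

abbreviation tuples :: "nat \<Rightarrow> 'a set \<Rightarrow> (nat \<Rightarrow> 'a) set" where
  "tuples n S \<equiv> {..<n} \<rightarrow>\<^sub>E S"

text \<open>The underlying set is the \<open>topspace\<close> of the topology. The interpretations of
  symbols outside the language are irrelevant.\<close>

record ('f, 'r, 'a) struct =
  str_top :: "'a topology"
  str_fun :: "'f \<Rightarrow> (nat \<Rightarrow> 'a) \<Rightarrow> 'a"
  str_rel :: "'r \<Rightarrow> (nat \<Rightarrow> 'a) set"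

abbreviation univ :: "('f, 'r, 'a) struct \<Rightarrow> 'a set" where
  "univ A \<equiv> topspace (str_top A)"

definition zero_dimensional_space :: "'a topology \<Rightarrow> bool" where
  "zero_dimensional_space X \<longleftrightarrow>
     (\<forall>U x. openin X U \<and> x \<in> U \<longrightarrow>
        (\<exists>V. openin X V \<and> closedin X V \<and> x \<in> V \<and> V \<subseteq> U))"

text \<open>Zero-dimensional spaces are understood to be Hausdorff; in particular the finite
  topological structures are exactly the finite discrete ones.\<close>

definition topological_structure :: "('f, 'r) language \<Rightarrow> ('f, 'r, 'a) struct \<Rightarrow> bool" where
  "topological_structure L A \<longleftrightarrow>
     compact_space (str_top A) \<and> Hausdorff_space (str_top A) \<and>
     zero_dimensional_space (str_top A) \<and> second_countable (str_top A) \<and>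
     (\<forall>q\<in>rel_syms L.
        closedin (product_topology (\<lambda>_. str_top A) {..<rel_arity L q}) (str_rel A q)) \<and>
     (\<forall>f\<in>fun_syms L.
        continuous_map (product_topology (\<lambda>_. str_top A) {..<fun_arity L f}) (str_top A)
          (str_fun A f))"

definition epimorphism ::
  "('f, 'r) language \<Rightarrow> ('f, 'r, 'b) struct \<Rightarrow> ('f, 'r, 'a) struct \<Rightarrow> ('b \<Rightarrow> 'a) \<Rightarrow> bool" where
  "epimorphism L B A \<phi> \<longleftrightarrow>
     continuous_map (str_top B) (str_top A) \<phi> \<and> \<phi> ` univ B = univ A \<and>
     (\<forall>f\<in>fun_syms L. \<forall>x\<in>tuples (fun_arity L f) (univ B).
        str_fun A f (\<lambda>i\<in>{..<fun_arity L f}. \<phi> (x i)) = \<phi> (str_fun B f x)) \<and>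
     (\<forall>q\<in>rel_syms L. \<forall>x\<in>tuples (rel_arity L q) (univ A).
        x \<in> str_rel A q \<longleftrightarrow>
        (\<exists>y\<in>tuples (rel_arity L q) (univ B).
           (\<forall>i<rel_arity L q. \<phi> (y i) = x i) \<and> y \<in> str_rel B q))"

definition struct_iso ::
  "('f, 'r) language \<Rightarrow> ('f, 'r, 'b) struct \<Rightarrow> ('f, 'r, 'a) struct \<Rightarrow> ('b \<Rightarrow> 'a) \<Rightarrow> bool" where
  "struct_iso L B A \<phi> \<longleftrightarrow> epimorphism L B A \<phi> \<and> bij_betw \<phi> (univ B) (univ A)"

definition JPP :: "('f, 'r) language \<Rightarrow> ('f, 'r, 'a) struct set \<Rightarrow> bool" where
  "JPP L \<F> \<longleftrightarrow>
     (\<forall>A\<in>\<F>. \<forall>B\<in>\<F>. \<exists>C\<in>\<F>. (\<exists>\<phi>. epimorphism L C A \<phi>) \<and> (\<exists>\<psi>. epimorphism L C B \<psi>))"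

definition AP :: "('f, 'r) language \<Rightarrow> ('f, 'r, 'a) struct set \<Rightarrow> bool" where
  "AP L \<F> \<longleftrightarrow>
     (\<forall>A\<in>\<F>. \<forall>B1\<in>\<F>. \<forall>B2\<in>\<F>. \<forall>\<phi>1 \<phi>2.
        epimorphism L B1 A \<phi>1 \<and> epimorphism L B2 A \<phi>2 \<longrightarrow>
        (\<exists>C\<in>\<F>. \<exists>\<phi>3 \<phi>4. epimorphism L C B1 \<phi>3 \<and> epimorphism L C B2 \<phi>4 \<and>
           (\<forall>x\<in>univ C. \<phi>1 (\<phi>3 x) = \<phi>2 (\<phi>4 x))))"

definition projective_Fraisse_family ::
  "('f, 'r) language \<Rightarrow> ('f, 'r, 'a) struct set \<Rightarrow> bool" where
  "projective_Fraisse_family L \<G> \<longleftrightarrow>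
     (\<forall>A\<in>\<G>. topological_structure L A \<and> finite (univ A)) \<and> JPP L \<G> \<and> AP L \<G>"

text \<open>Countability of a family of structures is meant up to isomorphism; this includes
  the families that are countable as sets.\<close>

definition countable_family :: "('f, 'r) language \<Rightarrow> ('f, 'r, 'a) struct set \<Rightarrow> bool" where
  "countable_family L \<G> \<longleftrightarrow>
     (\<exists>\<G>0\<subseteq>\<G>. countable \<G>0 \<and> (\<forall>A\<in>\<G>. \<exists>B\<in>\<G>0. \<exists>\<phi>. struct_iso L B A \<phi>))"

text \<open>In the second condition, the finite discrete spaces are taken on finite sets of
  natural numbers. This is no restriction, since each finite discrete space is
  homeomorphic to such a space.\<close>

definition projective_Fraisse_limit ::
  "('f, 'r) language \<Rightarrow> ('f, 'r, 'a) struct set \<Rightarrow> ('f, 'r, 'p) struct \<Rightarrow> bool" where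
  "projective_Fraisse_limit L \<G> P \<longleftrightarrow>
     topological_structure L P \<and>
     (\<forall>A\<in>\<G>. \<exists>\<phi>. epimorphism L P A \<phi>) \<and>
     (\<forall>(X :: nat set) f. finite X \<and> continuous_map (str_top P) (discrete_topology X) f \<longrightarrow>
        (\<exists>A\<in>\<G>. \<exists>\<phi> f0. epimorphism L P A \<phi> \<and> f0 \<in> univ A \<rightarrow> X \<and>
           (\<forall>x\<in>univ P. f x = f0 (\<phi> x)))) \<and>
     (\<forall>A\<in>\<G>. \<forall>\<phi>1 \<phi>2. epimorphism L P A \<phi>1 \<and> epimorphism L P A \<phi>2 \<longrightarrow>
        (\<exists>\<psi>. struct_iso L P P \<psi> \<and> (\<forall>x\<in>univ P. \<phi>2 x = \<phi>1 (\<psi> x))))"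

text \<open>As in \<^const>\<open>BijGroup\<close>, maps are made extensional so that each map on the
  underlying set is represented exactly once.\<close>

definition Aut :: "('f, 'r) language \<Rightarrow> ('f, 'r, 'p) struct \<Rightarrow> ('p \<Rightarrow> 'p) set" where
  "Aut L P = {f \<in> extensional (univ P). struct_iso L P P f}"

definition Aut_group :: "('f, 'r) language \<Rightarrow> ('f, 'r, 'p) struct \<Rightarrow> ('p \<Rightarrow> 'p) monoid" where
  "Aut_group L P = BijGroup (univ P) \<lparr>carrier := Aut L P\<rparr>"

definition compact_open_topology :: "'a topology \<Rightarrow> 'b topology \<Rightarrow> ('a \<Rightarrow> 'b) topology" where
  "compact_open_topology X Y =
     topology_generated_by
       {{f \<in> extensional (topspace X). continuous_map X Y f \<and> f ` K \<subseteq> U} | K U.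
          compactin X K \<and> openin Y U}"

definition homeomorphism_group_topology :: "'a topology \<Rightarrow> ('a \<Rightarrow> 'a) topology" where
  "homeomorphism_group_topology X =
     subtopology (compact_open_topology X X)
       {f \<in> extensional (topspace X). homeomorphic_map X X f}"

definition Aut_topology ::
  "('f, 'r) language \<Rightarrow> ('f, 'r, 'p) struct \<Rightarrow> ('p \<Rightarrow> 'p) topology" where
  "Aut_topology L P = subtopology (homeomorphism_group_topology (str_top P)) (Aut L P)"

definition conjugation :: "('g, 'm) monoid_scheme \<Rightarrow> 'g set \<Rightarrow> 'g \<Rightarrow> 'g \<Rightarrow> 'g" where
  "conjugation G H = (\<lambda>g. \<lambda>h\<in>H. g \<otimes>\<^bsub>G\<^esub> h \<otimes>\<^bsub>G\<^esub> inv\<^bsub>G\<^esub> g)"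

definition add_binary :: "('f, 'r) language \<Rightarrow> 'r \<Rightarrow> ('f, 'r) language" where
  "add_binary L s =
     L \<lparr>rel_syms := insert s (rel_syms L), rel_arity := (rel_arity L)(s := 2)\<rparr>"

definition expand ::
  "'r \<Rightarrow> ('f, 'r, 'a) struct \<Rightarrow> ('a \<times> 'a) set \<Rightarrow> ('f, 'r, 'a) struct" where
  "expand s A S =
     A \<lparr>str_rel := (str_rel A)(s := {x \<in> tuples 2 (univ A). (x 0, x 1) \<in> S})\<rparr>"

definition graph_on :: "'a set \<Rightarrow> ('a \<Rightarrow> 'a) \<Rightarrow> ('a \<times> 'a) set" where
  "graph_on X f = {(x, y). x \<in> X \<and> y \<in> X \<and> f x = y}"

definition induced_family ::
  "('f, 'r) language \<Rightarrow> 'r \<Rightarrow> ('f, 'r, 'a) struct set \<Rightarrow> ('f, 'r, 'p) struct \<Rightarrow>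
   ('p \<Rightarrow> 'p) set \<Rightarrow> ('f, 'r, 'a) struct set" where
  "induced_family L s \<G> P H =
     {expand s A S | A S. A \<in> \<G> \<and> S \<subseteq> univ A \<times> univ A \<and>
        (\<exists>\<phi>. epimorphism L P A \<phi> \<and>
           (\<exists>f\<in>H. epimorphism (add_binary L s) (expand s P (graph_on (univ P) f))
                    (expand s A S) \<phi>))}"

end

theory Submission
  imports Defs
begin

text \<open>For an epimorphism \<open>\<phi>\<close> from \<open>P\<close> onto some \<open>A \<in> \<G>\<close> and a relation \<open>S\<close> on \<open>A\<close>, let
  \<open>[\<phi>, S]\<close> be the set of all \<open>h \<in> H\<close> for which \<open>S\<close> is the image of the graph of \<open>h\<close> under
  \<open>\<phi>\<close>. By the second condition on the limit, these sets form a base of the topology of \<open>H\<close>; by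
  the third one, two sets \<open>[\<phi>, S]\<close> and \<open>[\<phi>', S]\<close> with the same target \<open>A\<close> are conjugate. The
  projection property says that any two of these sets have conjugates that meet, so that the union
  of the conjugates of \<open>[\<phi>, S]\<close> is open and, if nonempty, dense. Up to isomorphism there are
  countably many pairs \<open>(A, S)\<close>, so by Baire's theorem some \<open>h\<close> lies in all these unions, which
  means that its orbit is dense. Conversely, if the orbit of \<open>h\<close> is dense, then all members of the
  family are quotients of the single structure \<open>(P, h)\<close>, and any two of them factor through a
  common finite quotient of it.\<close>

section \<open>Epimorphisms\<close>

text \<open>Baire's theorem calls for complete metrizability of \<open>H\<close>, which as a closed
  subspace inherits it from \<open>Aut L P\<close>. The obstacle is that a uniform limit of
  automorphisms need not be injective. Therefore an automorphism is recorded by its action on the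
  countable clopen algebra together with the inverse action. In the product of discrete spaces such
  pairs form a closed set: compactness turns a limit of pairs into a homeomorphism, and closedness
  of the relations and continuity of the functions let it preserve the structure.

  A second obstacle sits in the claim that the sets \<open>[\<phi>, S]\<close> form a base. Knowing
  \<open>S\<close> means knowing which pairs occur in the quotient, not which pair belongs to a
  given point. Hence the quotient has to refine, besides the clopen sets that describe a
  neighbourhood of \<open>h\<close>, their preimages under \<open>h\<close>; then the class of
  \<open>x\<close> alone decides where \<open>h x\<close> lies.

  Conjugation enters only through one identity: pushing the conjugate of \<open>h\<close> by
  \<open>g\<close> forward along \<open>\<phi>\<close> is the same as pushing \<open>h\<close>
  forward along \<open>\<phi> \<circ> g\<close>.\<close>

lemma epimorphism_continuous: "epimorphism L B A \<phi> \<Longrightarrow> continuous_map (str_top B) (str_top A) \<phi>"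
  and epimorphism_image: "epimorphism L B A \<phi> \<Longrightarrow> \<phi> ` univ B = univ A"
  by (auto simp: epimorphism_def)

lemma epimorphism_in_univ: "epimorphism L B A \<phi> \<Longrightarrow> x \<in> univ B \<Longrightarrow> \<phi> x \<in> univ A"
  by (auto simp: epimorphism_def)

lemma epimorphism_fun:
  assumes "epimorphism L B A \<phi>" "F \<in> fun_syms L" "x \<in> tuples (fun_arity L F) (univ B)"
  shows "str_fun A F (\<lambda>i\<in>{..<fun_arity L F}. \<phi> (x i)) = \<phi> (str_fun B F x)"
  using assms by (auto simp: epimorphism_def)

lemma epimorphism_rel:
  assumes "epimorphism L B A \<phi>" "q \<in> rel_syms L" "x \<in> tuples (rel_arity L q) (univ A)"
  shows "x \<in> str_rel A q \<longleftrightarrow>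
    (\<exists>y\<in>tuples (rel_arity L q) (univ B). (\<forall>i<rel_arity L q. \<phi> (y i) = x i) \<and> y \<in> str_rel B q)"
  using assms by (auto simp: epimorphism_def)

lemma epimorphism_rel_image:
  assumes "epimorphism L B A \<phi>" "q \<in> rel_syms L" "y \<in> tuples (rel_arity L q) (univ B)"
    "y \<in> str_rel B q"
  shows "(\<lambda>i\<in>{..<rel_arity L q}. \<phi> (y i)) \<in> str_rel A q"
proof -
  have "(\<lambda>i\<in>{..<rel_arity L q}. \<phi> (y i)) \<in> tuples (rel_arity L q) (univ A)"
    using assms(3) epimorphism_in_univ[OF assms(1)] by (auto simp: PiE_iff)
  then show ?thesis
    using assms by (subst epimorphism_rel[OF assms(1,2)]) (auto intro!: bexI[of _ y])
qed

lemma str_fun_in_univ: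
  assumes "topological_structure L A" "F \<in> fun_syms L" "x \<in> tuples (fun_arity L F) (univ A)"
  shows "str_fun A F x \<in> univ A"
proof -
  have "continuous_map (product_topology (\<lambda>_. str_top A) {..<fun_arity L F}) (str_top A) (str_fun A F)"
    using assms by (simp add: topological_structure_def)
  from continuous_map_image_subset_topspace[OF this] assms(3) show ?thesis
    by auto
qed

lemma epimorphism_compose:
  assumes B: "topological_structure L B"
    and \<phi>: "epimorphism L C B \<phi>" and \<psi>: "epimorphism L B A \<psi>"
  shows "epimorphism L C A (\<psi> \<circ> \<phi>)"
  unfolding epimorphism_def
proof (intro conjI ballI)
  show "continuous_map (str_top C) (str_top A) (\<psi> \<circ> \<phi>)"
    using \<phi> \<psi> by (blast intro: continuous_map_compose epimorphism_continuous)
  show "(\<psi> \<circ> \<phi>) ` univ C = univ A"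
    using \<phi> \<psi> by (metis image_comp epimorphism_image)
next
  fix F x assume F: "F \<in> fun_syms L" and x: "x \<in> tuples (fun_arity L F) (univ C)"
  define y where "y = (\<lambda>i\<in>{..<fun_arity L F}. \<phi> (x i))"
  have "y \<in> tuples (fun_arity L F) (univ B)"
    using x epimorphism_in_univ[OF \<phi>] by (auto simp: y_def PiE_iff)
  from epimorphism_fun[OF \<psi> F this] epimorphism_fun[OF \<phi> F x]
  show "str_fun A F (\<lambda>i\<in>{..<fun_arity L F}. (\<psi> \<circ> \<phi>) (x i)) = (\<psi> \<circ> \<phi>) (str_fun C F x)"
    by (auto simp: y_def cong: restrict_cong)
next
  fix q x assume q: "q \<in> rel_syms L" and x: "x \<in> tuples (rel_arity L q) (univ A)"
  show "x \<in> str_rel A q \<longleftrightarrow>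
    (\<exists>y\<in>tuples (rel_arity L q) (univ C). (\<forall>i<rel_arity L q. (\<psi> \<circ> \<phi>) (y i) = x i) \<and> y \<in> str_rel C q)"
    (is "_ \<longleftrightarrow> ?R")
  proof
    assume "x \<in> str_rel A q"
    then obtain y where y: "y \<in> tuples (rel_arity L q) (univ B)" "\<forall>i<rel_arity L q. \<psi> (y i) = x i"
      "y \<in> str_rel B q" using epimorphism_rel[OF \<psi> q x] by auto
    then obtain z where "z \<in> tuples (rel_arity L q) (univ C)" "\<forall>i<rel_arity L q. \<phi> (z i) = y i"
      "z \<in> str_rel C q" using epimorphism_rel[OF \<phi> q y(1)] by auto
    then show ?R using y by (auto intro!: bexI[of _ z])
  next
    assume ?R
    then obtain z where z: "z \<in> tuples (rel_arity L q) (univ C)"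
      "\<forall>i<rel_arity L q. \<psi> (\<phi> (z i)) = x i" "z \<in> str_rel C q" by auto
    have "(\<lambda>i\<in>{..<rel_arity L q}. \<phi> (z i)) \<in> tuples (rel_arity L q) (univ B)"
      using z epimorphism_in_univ[OF \<phi>] by (auto simp: PiE_iff)
    with epimorphism_rel_image[OF \<phi> q z(1,3)] z(2)
    show "x \<in> str_rel A q"
      by (subst epimorphism_rel[OF \<psi> q x], intro bexI[of _ "\<lambda>i\<in>{..<rel_arity L q}. \<phi> (z i)"]) simp_all
  qed
qed

text \<open>Every tuple of \<open>C\<close> lifts coordinatewise along the surjection
  \<open>\<phi>\<close>, so each condition on \<open>\<alpha>\<close> can be checked in
  \<open>P\<close>, where it is a condition on \<open>\<psi>\<close>. Only continuity has to be
  supplied separately.\<close>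

lemma epimorphism_factor:
  assumes P: "topological_structure L P"
    and \<phi>: "epimorphism L P C \<phi>" and \<psi>: "epimorphism L P A \<psi>"
    and \<alpha>: "continuous_map (str_top C) (str_top A) \<alpha>" "\<And>x. x \<in> univ P \<Longrightarrow> \<alpha> (\<phi> x) = \<psi> x"
  shows "epimorphism L C A \<alpha>"
  unfolding epimorphism_def
proof (intro conjI ballI)
  show "\<alpha> ` univ C = univ A"
    unfolding epimorphism_image[OF \<phi>, symmetric] epimorphism_image[OF \<psi>, symmetric] image_image
    using \<alpha>(2) by auto
next
  fix F x assume F: "F \<in> fun_syms L" and x: "x \<in> tuples (fun_arity L F) (univ C)"
  define y where "y = (\<lambda>i\<in>{..<fun_arity L F}. inv_into (univ P) \<phi> (x i))"
  have y: "y \<in> tuples (fun_arity L F) (univ P)"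
    using x by (auto simp: y_def PiE_iff inv_into_into epimorphism_image[OF \<phi>])
  have xy: "x = (\<lambda>i\<in>{..<fun_arity L F}. \<phi> (y i))"
    using x by (auto simp: y_def fun_eq_iff PiE_iff f_inv_into_f epimorphism_image[OF \<phi>] extensional_def)
  have "\<alpha> (x i) = \<psi> (y i)" if "i < fun_arity L F" for i
    unfolding xy using that y by (auto simp: \<alpha>(2) PiE_iff)
  then have "str_fun A F (\<lambda>i\<in>{..<fun_arity L F}. \<alpha> (x i)) = str_fun A F (\<lambda>i\<in>{..<fun_arity L F}. \<psi> (y i))"
    by (auto cong: restrict_cong)
  also have "\<dots> = \<alpha> (\<phi> (str_fun P F y))"
    using epimorphism_fun[OF \<psi> F y] str_fun_in_univ[OF P F y] \<alpha>(2) by simp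
  also have "\<dots> = \<alpha> (str_fun C F x)"
    using epimorphism_fun[OF \<phi> F y] xy by simp
  finally show "str_fun A F (\<lambda>i\<in>{..<fun_arity L F}. \<alpha> (x i)) = \<alpha> (str_fun C F x)" .
next
  fix q x assume q: "q \<in> rel_syms L" and x: "x \<in> tuples (rel_arity L q) (univ A)"
  show "x \<in> str_rel A q \<longleftrightarrow>
    (\<exists>y\<in>tuples (rel_arity L q) (univ C). (\<forall>i<rel_arity L q. \<alpha> (y i) = x i) \<and> y \<in> str_rel C q)"
    (is "_ \<longleftrightarrow> ?R")
  proof
    assume "x \<in> str_rel A q"
    then obtain y where y: "y \<in> tuples (rel_arity L q) (univ P)" "\<forall>i<rel_arity L q. \<psi> (y i) = x i"
      "y \<in> str_rel P q" using epimorphism_rel[OF \<psi> q x] by auto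
    have "(\<lambda>i\<in>{..<rel_arity L q}. \<phi> (y i)) \<in> tuples (rel_arity L q) (univ C)"
      using y epimorphism_in_univ[OF \<phi>] by (auto simp: PiE_iff)
    moreover have "\<alpha> (\<phi> (y i)) = x i" if "i < rel_arity L q" for i
      using that y(2) \<alpha>(2)[of "y i"] PiE_mem[OF y(1), of i] by simp
    ultimately show ?R
      using epimorphism_rel_image[OF \<phi> q y(1,3)]
      by (intro bexI[of _ "\<lambda>i\<in>{..<rel_arity L q}. \<phi> (y i)"]) simp_all
  next
    assume ?R
    then obtain z where z: "z \<in> tuples (rel_arity L q) (univ C)"
      "\<forall>i<rel_arity L q. \<alpha> (z i) = x i" "z \<in> str_rel C q" by auto
    then obtain y where y: "y \<in> tuples (rel_arity L q) (univ P)" "\<forall>i<rel_arity L q. \<phi> (y i) = z i"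
      "y \<in> str_rel P q" using epimorphism_rel[OF \<phi> q z(1)] by auto
    have "\<psi> (y i) = x i" if "i < rel_arity L q" for i
      using that y(2) z(2) \<alpha>(2)[of "y i"] PiE_mem[OF y(1), of i] by simp
    then show "x \<in> str_rel A q"
      using y(1,3) by (subst epimorphism_rel[OF \<psi> q x], intro bexI[of _ y]) simp_all
  qed
qed (rule \<alpha>(1))

lemma epimorphism_ident: "epimorphism L B B (\<lambda>x. x)"
  unfolding epimorphism_def
proof (intro conjI ballI)
  fix F x assume "x \<in> tuples (fun_arity L F) (univ B)"
  then show "str_fun B F (\<lambda>i\<in>{..<fun_arity L F}. x i) = str_fun B F x"
    by (metis PiE_restrict)
next
  fix q x assume x: "x \<in> tuples (rel_arity L q) (univ B)"
  have "y = x" if "y \<in> tuples (rel_arity L q) (univ B)" "\<forall>i<rel_arity L q. y i = x i" for y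
    using that x by (auto intro: PiE_ext)
  with x show "x \<in> str_rel B q \<longleftrightarrow> (\<exists>y\<in>tuples (rel_arity L q) (univ B).
      (\<forall>i<rel_arity L q. y i = x i) \<and> y \<in> str_rel B q)"
    by blast
qed simp_all

text \<open>A map that agrees with \<open>\<phi>\<close> on the underlying set factors
  \<open>\<phi>\<close> through the identity epimorphism, so the factorization lemma applies to
  it.\<close>

lemma epimorphism_cong:
  assumes "topological_structure L B" "\<And>x. x \<in> univ B \<Longrightarrow> \<phi> x = \<psi> x"
  shows "epimorphism L B A \<phi> \<longleftrightarrow> epimorphism L B A \<psi>"
proof -
  have "epimorphism L B A \<psi>" if \<phi>: "epimorphism L B A \<phi>" and eq: "\<And>x. x \<in> univ B \<Longrightarrow> \<phi> x = \<psi> x" for \<phi> \<psi>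
  proof (rule epimorphism_factor[OF assms(1) epimorphism_ident \<phi>])
    show "continuous_map (str_top B) (str_top A) \<psi>"
      using continuous_map_eq epimorphism_continuous[OF \<phi>] eq by blast
    show "\<psi> x = \<phi> x" if "x \<in> univ B" for x using eq[OF that] by (rule sym)
  qed
  then show ?thesis using assms(2) by metis
qed

text \<open>A continuous bijection from a compact space to a Hausdorff space is a homeomorphism,
  which makes the inverse continuous; the symbols are then handled by factoring the identity of
  \<open>B\<close> through \<open>\<phi>\<close>.\<close>

lemma struct_iso_inverse:
  assumes B: "topological_structure L B" and A: "topological_structure L A"
    and \<phi>: "struct_iso L B A \<phi>"
  shows "struct_iso L A B (inv_into (univ B) \<phi>)"
proof -
  have e: "epimorphism L B A \<phi>" and b: "bij_betw \<phi> (univ B) (univ A)"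
    using \<phi> by (auto simp: struct_iso_def)
  have "homeomorphic_map (str_top B) (str_top A) \<phi>"
    using A B b epimorphism_continuous[OF e] by (intro continuous_imp_homeomorphic_map)
      (simp_all add: topological_structure_def bij_betw_def)
  then obtain g where g: "continuous_map (str_top A) (str_top B) g" "\<And>x. x \<in> univ B \<Longrightarrow> g (\<phi> x) = x"
    unfolding homeomorphic_map_maps homeomorphic_maps_def by blast
  have inv: "inv_into (univ B) \<phi> (\<phi> x) = x" if "x \<in> univ B" for x
    using b that by (simp add: bij_betw_def)
  have "continuous_map (str_top A) (str_top B) (inv_into (univ B) \<phi>)"
  proof (rule continuous_map_eq[OF g(1)])
    fix y assume "y \<in> univ A"
    then obtain x where "x \<in> univ B" "y = \<phi> x"
      using epimorphism_image[OF e] by blast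
    then show "g y = inv_into (univ B) \<phi> y" using g(2) inv by simp
  qed
  then have "epimorphism L A B (inv_into (univ B) \<phi>)"
    using inv by (rule epimorphism_factor[OF B e epimorphism_ident])
  then show ?thesis
    using b by (simp add: struct_iso_def bij_betw_inv_into)
qed

section \<open>Structures expanded by a binary relation\<close>

lemma ball_tuples_2: "(\<forall>x\<in>tuples 2 S. Q (x 0) (x 1)) \<longleftrightarrow> (\<forall>a\<in>S. \<forall>b\<in>S. Q a b)"
proof (intro iffI ballI)
  fix a b assume Q: "\<forall>x\<in>tuples 2 S. Q (x 0) (x 1)" and "a \<in> S" "b \<in> S"
  then have "(\<lambda>i\<in>{..<2}. if i = (0::nat) then a else b) \<in> tuples 2 S" by auto
  from Q[rule_format, OF this] show "Q a b" by simp
qed (auto simp: PiE_iff)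

lemma bex_tuples_2: "(\<exists>x\<in>tuples 2 S. Q (x 0) (x 1)) \<longleftrightarrow> (\<exists>a\<in>S. \<exists>b\<in>S. Q a b)"
  using ball_tuples_2[of S "\<lambda>a b. \<not> Q a b"] by blast

text \<open>For the new symbol the epimorphism clause says that a pair lies in \<open>S\<close>
  exactly if it lifts to a pair in \<open>T\<close>, so \<open>S\<close> is determined by
  \<open>T\<close> and \<open>\<phi>\<close>. This allows the expanded language to be replaced by
  direct images of relations from here on.\<close>

lemma epimorphism_expand:
  assumes s: "s \<notin> rel_syms L" and T: "T \<subseteq> univ B \<times> univ B" and S: "S \<subseteq> univ A \<times> univ A"
  shows "epimorphism (add_binary L s) (expand s B T) (expand s A S) \<phi> \<longleftrightarrow>
    epimorphism L B A \<phi> \<and> map_prod \<phi> \<phi> ` T = S"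
proof -
  have rel: "(\<forall>q\<in>rel_syms (add_binary L s). \<forall>x\<in>tuples (rel_arity (add_binary L s) q) (univ A).
        x \<in> str_rel (expand s A S) q \<longleftrightarrow>
        (\<exists>y\<in>tuples (rel_arity (add_binary L s) q) (univ B).
           (\<forall>i<rel_arity (add_binary L s) q. \<phi> (y i) = x i) \<and> y \<in> str_rel (expand s B T) q)) \<longleftrightarrow>
     (\<forall>q\<in>rel_syms L. \<forall>x\<in>tuples (rel_arity L q) (univ A).
        x \<in> str_rel A q \<longleftrightarrow>
        (\<exists>y\<in>tuples (rel_arity L q) (univ B).
           (\<forall>i<rel_arity L q. \<phi> (y i) = x i) \<and> y \<in> str_rel B q)) \<and>
     (\<forall>x\<in>tuples 2 (univ A). (x 0, x 1) \<in> S \<longleftrightarrow>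
        (\<exists>y\<in>tuples 2 (univ B). (\<forall>i<2. \<phi> (y i) = x i) \<and> (y 0, y 1) \<in> T))"
    (is "?l \<longleftrightarrow> ?r1 \<and> ?r2")
  proof -
    \<comment> \<open>Freshness of \<open>s\<close> keeps the function updates in arity and
      interpretation away from the old symbols.\<close>
    have "q \<noteq> s" if "q \<in> rel_syms L" for q using s that by auto
    then show ?thesis
      by (simp add: add_binary_def expand_def conj_commute)
  qed
  have img: "?r2 \<longleftrightarrow> map_prod \<phi> \<phi> ` T = S" if \<phi>: "\<phi> ` univ B = univ A"
  proof -
    have two: "(\<forall>i<2. R i) \<longleftrightarrow> R 0 \<and> R 1" for R :: "nat \<Rightarrow> bool"
      by (auto simp: numeral_2_eq_2 less_Suc_eq)
    have "?r2 \<longleftrightarrow> (\<forall>x\<in>tuples 2 (univ A). (x 0, x 1) \<in> S \<longleftrightarrow>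
        (\<exists>u\<in>univ B. \<exists>v\<in>univ B. (\<phi> u = x 0 \<and> \<phi> v = x 1) \<and> (u, v) \<in> T))"
      unfolding two
      by (subst bex_tuples_2[where Q = "\<lambda>u v. (\<phi> u = x 0 \<and> \<phi> v = x 1) \<and> (u, v) \<in> T" for x]) simp
    also have "\<dots> \<longleftrightarrow> (\<forall>a\<in>univ A. \<forall>b\<in>univ A. (a, b) \<in> S \<longleftrightarrow>
        (\<exists>u\<in>univ B. \<exists>v\<in>univ B. (\<phi> u = a \<and> \<phi> v = b) \<and> (u, v) \<in> T))"
      by (rule ball_tuples_2)
    also have "\<dots> \<longleftrightarrow> (\<forall>p. p \<in> S \<longleftrightarrow> p \<in> map_prod \<phi> \<phi> ` T)"
    proof -
      have "(a, b) \<in> map_prod \<phi> \<phi> ` T \<longleftrightarrow>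
          (\<exists>u\<in>univ B. \<exists>v\<in>univ B. (\<phi> u = a \<and> \<phi> v = b) \<and> (u, v) \<in> T)" for a b
        using T by force
      note this[symmetric]
      moreover have "map_prod \<phi> \<phi> ` T \<subseteq> univ A \<times> univ A" using T \<phi> by auto
      ultimately show ?thesis using S by (simp only:) blast
    qed
    finally show ?thesis by auto
  qed
  have expand: "str_top (expand s A S) = str_top A" "str_fun (expand s A S) = str_fun A"
    "str_top (expand s B T) = str_top B" "str_fun (expand s B T) = str_fun B"
    "fun_syms (add_binary L s) = fun_syms L" "fun_arity (add_binary L s) = fun_arity L"
    by (simp_all add: expand_def add_binary_def)
  have "epimorphism (add_binary L s) (expand s B T) (expand s A S) \<phi> \<longleftrightarrow> epimorphism L B A \<phi> \<and> ?r2"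
    unfolding epimorphism_def expand rel by (simp only: conj_assoc)
  \<comment> \<open>The image form of the clause relies on surjectivity of \<open>\<phi>\<close>, so
    it is rewritten under the first conjunct, which provides it.\<close>
  also have "\<dots> \<longleftrightarrow> epimorphism L B A \<phi> \<and> map_prod \<phi> \<phi> ` T = S"
    by (rule conj_cong[OF refl], rule img, erule epimorphism_image)
  finally show ?thesis .
qed

section \<open>Clopen sets\<close>

definition clopens :: "'a topology \<Rightarrow> 'a set set" where
  "clopens X = {C. openin X C \<and> closedin X C}"

lemma clopens_diff: "C \<in> clopens X \<Longrightarrow> topspace X - C \<in> clopens X"
  by (auto simp: clopens_def)

lemma clopens_subset: "C \<in> clopens X \<Longrightarrow> C \<subseteq> topspace X"
  by (auto simp: clopens_def openin_subset)

lemma clopens_topspace: "topspace X \<in> clopens X"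
  by (auto simp: clopens_def)

lemma clopens_preimage:
  "continuous_map X Y f \<Longrightarrow> C \<in> clopens Y \<Longrightarrow> {x \<in> topspace X. f x \<in> C} \<in> clopens X"
  by (auto simp: clopens_def openin_continuous_map_preimage closedin_continuous_map_preimage)

lemma clopen_nbhd:
  assumes "zero_dimensional_space X" "openin X U" "x \<in> U"
  obtains C where "C \<in> clopens X" "x \<in> C" "C \<subseteq> U"
  using assms unfolding zero_dimensional_space_def clopens_def by blast

lemma clopen_separation:
  assumes "zero_dimensional_space X" "Hausdorff_space X" "x \<in> topspace X" "y \<in> topspace X"
    and "\<And>C. C \<in> clopens X \<Longrightarrow> x \<in> C \<Longrightarrow> y \<in> C"
  shows "x = y"
proof (rule ccontr)
  assume "x \<noteq> y"
  then obtain U V where "openin X U" "openin X V" "x \<in> U" "y \<in> V" "disjnt U V"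
    using assms unfolding Hausdorff_space_def by metis
  moreover from this obtain C where "C \<in> clopens X" "x \<in> C" "C \<subseteq> U"
    using clopen_nbhd[OF assms(1)] by metis
  ultimately show False using assms(5) by (auto simp: disjnt_iff)
qed

text \<open>A clopen set is open and compact, hence a finite union of sets from a countable base.
  Countability is what makes the product indexed by the clopen sets metrizable.\<close>

lemma countable_clopens:
  assumes "compact_space X" "second_countable X"
  shows "countable (clopens X)"
proof -
  obtain \<B> where \<B>: "countable \<B>" "\<And>V. V \<in> \<B> \<Longrightarrow> openin X V"
    "\<And>U x. openin X U \<Longrightarrow> x \<in> U \<Longrightarrow> \<exists>V\<in>\<B>. x \<in> V \<and> V \<subseteq> U"
    using assms(2) unfolding second_countable_def by metis
  have "C \<in> Union ` {\<F>. finite \<F> \<and> \<F> \<subseteq> \<B>}" if "C \<in> clopens X" for C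
  proof -
    have C: "openin X C" "compactin X C"
      using that assms(1) by (auto simp: clopens_def closedin_compact_space)
    have "C \<subseteq> \<Union>{V\<in>\<B>. V \<subseteq> C}" using \<B>(3)[OF C(1)] by blast
    then obtain \<F> where "finite \<F>" "\<F> \<subseteq> {V\<in>\<B>. V \<subseteq> C}" "C \<subseteq> \<Union>\<F>"
      using compactinD[OF C(2)] \<B>(2) by (metis (no_types, lifting) mem_Collect_eq)
    then show ?thesis by (intro image_eqI[of _ _ \<F>]) auto
  qed
  then show ?thesis
    by (intro countable_subset[OF _ countable_image[OF countable_Collect_finite_subset[OF \<B>(1)]]]) auto
qed

text \<open>The predicate \<open>t\<close> prescribes which clopen sets are to contain the point.
  Finite realizability makes it an ultrafilter of the clopen algebra; compactness yields a point,
  and separation by clopen sets its uniqueness.\<close>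

lemma ex1_point_of_clopen_ultrafilter:
  assumes "compact_space X" "zero_dimensional_space X" "Hausdorff_space X"
    and fin: "\<And>\<C>. finite \<C> \<Longrightarrow> \<C> \<subseteq> clopens X \<Longrightarrow> \<exists>y\<in>topspace X. \<forall>C\<in>\<C>. y \<in> C \<longleftrightarrow> t C"
  shows "\<exists>!y. y \<in> topspace X \<and> (\<forall>C\<in>clopens X. y \<in> C \<longleftrightarrow> t C)"
proof -
  define D where "D C = (if t C then C else topspace X - C)" for C
  have in_D: "y \<in> D C \<longleftrightarrow> (y \<in> C \<longleftrightarrow> t C)" if "y \<in> topspace X" for y C
    using that by (auto simp: D_def)
  have "\<Inter> (D ` clopens X) \<noteq> {}"
  proof (rule assms(1)[unfolded compact_space_fip, rule_format], intro conjI ballI allI impI)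
    show "closedin X E" if "E \<in> D ` clopens X" for E
      using that by (auto simp: D_def clopens_def)
    fix \<F> assume "finite \<F> \<and> \<F> \<subseteq> D ` clopens X"
    then obtain \<C> where \<C>: "\<C> \<subseteq> clopens X" "finite \<C>" "\<F> = D ` \<C>"
      by (meson finite_subset_image)
    with fin obtain y where "y \<in> topspace X" "\<forall>C\<in>\<C>. y \<in> C \<longleftrightarrow> t C" by blast
    then have "y \<in> \<Inter> \<F>" using in_D \<C>(3) by auto
    then show "\<Inter> \<F> \<noteq> {}" by blast
  qed
  then obtain y where y: "\<And>C. C \<in> clopens X \<Longrightarrow> y \<in> D C" by blast
  \<comment> \<open>The whole space is itself a clopen set on which \<open>t\<close> must be true;
    this is what places \<open>y\<close> in the space.\<close>
  have "t (topspace X)" using fin[of "{topspace X}"] clopens_topspace by auto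
  then have yX: "y \<in> topspace X" using y[OF clopens_topspace] by (simp add: D_def)
  show ?thesis
  proof (rule ex1I[of _ y])
    show "y \<in> topspace X \<and> (\<forall>C\<in>clopens X. y \<in> C \<longleftrightarrow> t C)"
      using yX y in_D by blast
    then show "z = y" if "z \<in> topspace X \<and> (\<forall>C\<in>clopens X. z \<in> C \<longleftrightarrow> t C)" for z
      using that by (intro clopen_separation[OF assms(2,3)]) auto
  qed
qed

text \<open>Boxes of clopen sets form a neighbourhood base of \<open>y\<close>, and a finite index
  set needs only finitely many of them. In this form closed relations are carried over to limits of
  automorphisms.\<close>

lemma closedin_product_clopen_limit:
  assumes "zero_dimensional_space X" and R: "closedin (product_topology (\<lambda>_. X) I) R"
    and "finite I" and y: "y \<in> I \<rightarrow>\<^sub>E topspace X"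
    and lim: "\<And>\<C>. finite \<C> \<Longrightarrow> \<C> \<subseteq> clopens X \<Longrightarrow> \<exists>z\<in>R. \<forall>i\<in>I. \<forall>C\<in>\<C>. y i \<in> C \<longrightarrow> z i \<in> C"
  shows "y \<in> R"
proof (rule ccontr)
  assume "y \<notin> R"
  then have y': "y \<in> topspace (product_topology (\<lambda>_. X) I) - R" using y by simp
  have "openin (product_topology (\<lambda>_. X) I) (topspace (product_topology (\<lambda>_. X) I) - R)"
    using R by blast
  from product_topology_open_contains_basis[OF this y'] obtain U where U: "y \<in> Pi\<^sub>E I U"
    "\<And>i. openin X (U i)" "Pi\<^sub>E I U \<subseteq> topspace (product_topology (\<lambda>_. X) I) - R" by blast
  have "\<exists>C\<in>clopens X. y i \<in> C \<and> C \<subseteq> U i" if "i \<in> I" for i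
    using clopen_nbhd[OF assms(1) U(2)] PiE_mem[OF U(1) that] by metis
  then obtain C where C: "\<And>i. i \<in> I \<Longrightarrow> C i \<in> clopens X \<and> y i \<in> C i \<and> C i \<subseteq> U i" by metis
  obtain z where z: "z \<in> R" "\<forall>i\<in>I. \<forall>D\<in>C ` I. y i \<in> D \<longrightarrow> z i \<in> D"
  proof -
    have "finite (C ` I)" "C ` I \<subseteq> clopens X" using C assms(3) by auto
    from lim[OF this] show ?thesis by (elim bexE) (rule that)
  qed
  have "z \<in> I \<rightarrow>\<^sub>E topspace X" using closedin_subset[OF R] z(1) by auto
  moreover have "z i \<in> U i" if "i \<in> I" for i
    using C[OF that] z(2)[rule_format, OF that imageI[OF that]] by blast
  ultimately have "z \<in> Pi\<^sub>E I U" by (simp add: PiE_iff)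
  then show False using U(3) z(1) by blast
qed

lemma openin_finite_Ball:
  assumes "finite I" "\<And>i. i \<in> I \<Longrightarrow> openin X {x \<in> topspace X. Q i x}"
  shows "openin X {x \<in> topspace X. \<forall>i\<in>I. Q i x}"
  using assms
proof (induction I rule: finite_induct)
  case (insert i I)
  have "{x \<in> topspace X. \<forall>j\<in>insert i I. Q j x} =
    {x \<in> topspace X. Q i x} \<inter> {x \<in> topspace X. \<forall>j\<in>I. Q j x}" by auto
  then show ?case using insert by (simp add: openin_Int)
qed simp

lemma continuous_map_to_discrete_topology:
  assumes "f \<in> topspace X \<rightarrow> S" "\<And>y. y \<in> S \<Longrightarrow> openin X {x \<in> topspace X. f x = y}"
  shows "continuous_map X (discrete_topology S) f"
  unfolding continuous_map_def
proof (intro conjI allI impI)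
  fix U assume "openin (discrete_topology S) U"
  then have "{x \<in> topspace X. f x \<in> U} = (\<Union>y\<in>U. {x \<in> topspace X. f x = y})" "U \<subseteq> S" by auto
  with assms(2) show "openin X {x \<in> topspace X. f x \<in> U}" by (auto intro!: openin_Union)
qed (use assms in auto)

text \<open>For a subbasic set given by \<open>K\<close> and \<open>U\<close>, finitely many clopen
  subsets of \<open>U\<close> cover the compact image of \<open>K\<close> under \<open>h\<close>. A
  map with the same preimages of these sets as \<open>h\<close> also sends \<open>K\<close> into
  \<open>U\<close>.\<close>

lemma compact_open_clopen_nbhd:
  assumes "zero_dimensional_space Y" "openin (compact_open_topology X Y) U" "h \<in> U"
  obtains \<C> where "finite \<C>" "\<C> \<subseteq> clopens Y"
    "\<And>g. g \<in> extensional (topspace X) \<Longrightarrow> continuous_map X Y g \<Longrightarrow>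
      (\<And>C x. C \<in> \<C> \<Longrightarrow> x \<in> topspace X \<Longrightarrow> g x \<in> C \<longleftrightarrow> h x \<in> C) \<Longrightarrow> g \<in> U"
proof -
  \<comment> \<open>\<open>N\<close> packages the conclusion so that the induction over the
    generation of open sets can combine it: unions of families for intersections, any one family for
    unions.\<close>
  define N where "N \<C> U \<longleftrightarrow> (\<forall>g\<in>extensional (topspace X). continuous_map X Y g \<longrightarrow>
      (\<forall>C\<in>\<C>. \<forall>x\<in>topspace X. g x \<in> C \<longleftrightarrow> h x \<in> C) \<longrightarrow> g \<in> U)" for \<C> U
  have "generate_topology_on {{f \<in> extensional (topspace X). continuous_map X Y f \<and> f ` K \<subseteq> U} | K U.
          compactin X K \<and> openin Y U} U"
    using assms(2) by (simp add: compact_open_topology_def openin_topology_generated_by_iff)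
  from this assms(3) have "\<exists>\<C>. finite \<C> \<and> \<C> \<subseteq> clopens Y \<and> N \<C> U"
  proof (induction rule: generate_topology_on.induct)
    case (Int a b)
    then have h: "h \<in> a" "h \<in> b" by simp_all
    from Int.IH(1)[OF h(1)] obtain \<C> where \<C>: "finite \<C>" "\<C> \<subseteq> clopens Y" "N \<C> a" by (elim exE conjE)
    from Int.IH(2)[OF h(2)] obtain \<D> where \<D>: "finite \<D>" "\<D> \<subseteq> clopens Y" "N \<D> b" by (elim exE conjE)
    have "N (\<C> \<union> \<D>) (a \<inter> b)" using \<C>(3) \<D>(3) by (simp add: N_def)
    then show ?case using \<C> \<D> by (intro exI[of _ "\<C> \<union> \<D>"]) simp
  next
    case (UN K)
    then obtain k where k: "k \<in> K" "h \<in> k" by blast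
    from UN.IH[OF k] obtain \<C> where \<C>: "finite \<C>" "\<C> \<subseteq> clopens Y" "N \<C> k" by (elim exE conjE)
    then have "N \<C> (\<Union>K)" using k(1) by (simp add: N_def) blast
    with \<C> show ?case by (intro exI[of _ \<C>]) simp
  next
    case (Basis S)
    then obtain K V where S: "S = {f \<in> extensional (topspace X). continuous_map X Y f \<and> f ` K \<subseteq> V}"
      "compactin X K" "openin Y V" by blast
    then have "continuous_map X Y h" "h ` K \<subseteq> V" using Basis.prems by simp_all
    then have "compactin Y (h ` K)" using image_compactin S(2) by blast
    moreover have "h ` K \<subseteq> \<Union>{C \<in> clopens Y. C \<subseteq> V}"
    proof
      fix y assume "y \<in> h ` K"
      with \<open>h ` K \<subseteq> V\<close> have "y \<in> V" by blast
      then show "y \<in> \<Union>{C \<in> clopens Y. C \<subseteq> V}" using clopen_nbhd[OF assms(1) S(3)] by blast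
    qed
    moreover have "openin Y C" if "C \<in> {C \<in> clopens Y. C \<subseteq> V}" for C
      using that by (simp add: clopens_def)
    ultimately obtain \<C> where \<C>: "finite \<C>" "\<C> \<subseteq> {C \<in> clopens Y. C \<subseteq> V}" "h ` K \<subseteq> \<Union>\<C>"
      using compactinD[of Y "h ` K" "{C \<in> clopens Y. C \<subseteq> V}"] by blast
    have "K \<subseteq> topspace X" using S(2) by (rule compactin_subset_topspace)
    have "g \<in> S" if g: "g \<in> extensional (topspace X)" "continuous_map X Y g"
      "\<forall>C\<in>\<C>. \<forall>x\<in>topspace X. g x \<in> C \<longleftrightarrow> h x \<in> C" for g
    proof -
      have "g x \<in> V" if "x \<in> K" for x
      proof -
        have "h x \<in> \<Union>\<C>" using \<C>(3) that by (rule subsetD[OF _ imageI])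
        then obtain C where C: "C \<in> \<C>" "h x \<in> C" by (rule UnionE)
        moreover have "x \<in> topspace X" using \<open>K \<subseteq> topspace X\<close> that by (rule subsetD)
        ultimately have "g x \<in> C" using g(3) by simp
        moreover have "C \<subseteq> V" using \<C>(2) C(1) by auto
        ultimately show ?thesis by (rule subsetD[rotated])
      qed
      then show ?thesis using g by (auto simp: S(1))
    qed
    then have "N \<C> S" by (simp add: N_def)
    then show ?case using \<C> by (intro exI[of _ \<C>]) auto
  qed simp
  then show ?thesis unfolding N_def by (elim exE conjE) (rule that, assumption+, blast)
qed

section \<open>The automorphism group\<close>

lemma Aut_extensional: "f \<in> Aut L P \<Longrightarrow> f \<in> extensional (univ P)"
  and Aut_epimorphism: "f \<in> Aut L P \<Longrightarrow> epimorphism L P P f"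
  and Aut_bij_betw: "f \<in> Aut L P \<Longrightarrow> bij_betw f (univ P) (univ P)"
  by (auto simp: Aut_def struct_iso_def)

lemma Aut_continuous: "f \<in> Aut L P \<Longrightarrow> continuous_map (str_top P) (str_top P) f"
  by (blast intro: Aut_epimorphism epimorphism_continuous)

lemma Aut_in_univ: "f \<in> Aut L P \<Longrightarrow> x \<in> univ P \<Longrightarrow> f x \<in> univ P"
  by (blast intro: bij_betwE[THEN bspec] Aut_bij_betw)

lemma Aut_eq_iff: "f \<in> Aut L P \<Longrightarrow> x \<in> univ P \<Longrightarrow> y \<in> univ P \<Longrightarrow> f x = f y \<longleftrightarrow> x = y"
  using Aut_bij_betw[of f L P] by (auto simp: bij_betw_def inj_on_def)

lemma Aut_surj:
  assumes "f \<in> Aut L P" "y \<in> univ P"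
  obtains x where "x \<in> univ P" "y = f x"
  using Aut_bij_betw[OF assms(1)] assms(2) by (auto simp: bij_betw_def)

lemma Aut_homeomorphic_map:
  assumes "topological_structure L P" "f \<in> Aut L P"
  shows "homeomorphic_map (str_top P) (str_top P) f"
  using assms Aut_continuous[OF assms(2)] Aut_bij_betw[OF assms(2)]
  by (intro continuous_imp_homeomorphic_map) (simp_all add: topological_structure_def bij_betw_def)

text \<open>Isomorphisms are arbitrary outside the underlying set, whereas members of
  \<open>Aut\<close> are extensional; restricting converts the former into the latter.\<close>

lemma restrict_in_Aut:
  assumes "topological_structure L P" "struct_iso L P P \<psi>"
  shows "restrict \<psi> (univ P) \<in> Aut L P"
proof -
  have "epimorphism L P P (restrict \<psi> (univ P))"
    using assms(2) by (subst epimorphism_cong[OF assms(1), where \<psi> = \<psi>]) (simp_all add: struct_iso_def)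
  moreover have "bij_betw (restrict \<psi> (univ P)) (univ P) (univ P)"
    using assms(2) by (simp add: struct_iso_def)
  ultimately show ?thesis by (simp add: Aut_def struct_iso_def)
qed

lemma Aut_subset_Bij: "Aut L P \<subseteq> Bij (univ P)"
  by (auto simp: Aut_def Bij_def struct_iso_def)

lemma subgroup_Aut:
  assumes P: "topological_structure L P"
  shows "subgroup (Aut L P) (BijGroup (univ P))"
proof
  show "Aut L P \<subseteq> carrier (BijGroup (univ P))"
    using Aut_subset_Bij by (auto simp: BijGroup_def)
  have "struct_iso L P P (\<lambda>x. x)"
    using epimorphism_ident[of L P] by (simp add: struct_iso_def bij_betw_def)
  then show "\<one>\<^bsub>BijGroup (univ P)\<^esub> \<in> Aut L P"
    using restrict_in_Aut[OF P] by (simp add: BijGroup_def)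
  fix f g assume f: "f \<in> Aut L P" and g: "g \<in> Aut L P"
  have "epimorphism L P P (f \<circ> g)"
    using epimorphism_compose[OF P Aut_epimorphism[OF g] Aut_epimorphism[OF f]] .
  moreover have "bij_betw (f \<circ> g) (univ P) (univ P)"
    using bij_betw_trans[OF Aut_bij_betw[OF g] Aut_bij_betw[OF f]] .
  ultimately have "restrict (f \<circ> g) (univ P) \<in> Aut L P"
    by (intro restrict_in_Aut[OF P]) (simp add: struct_iso_def)
  moreover have "f \<otimes>\<^bsub>BijGroup (univ P)\<^esub> g = restrict (f \<circ> g) (univ P)"
    using f g Aut_subset_Bij by (auto simp: BijGroup_def compose_def fun_eq_iff subset_iff)
  ultimately show "f \<otimes>\<^bsub>BijGroup (univ P)\<^esub> g \<in> Aut L P" by simp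
next
  fix f assume f: "f \<in> Aut L P"
  then have "struct_iso L P P f" by (simp add: Aut_def)
  with f show "inv\<^bsub>BijGroup (univ P)\<^esub> f \<in> Aut L P"
    using Aut_subset_Bij[of L P] restrict_in_Aut[OF P struct_iso_inverse[OF P P]]
    by (simp add: inv_BijGroup subset_iff)
qed

lemma group_Aut_group: "topological_structure L P \<Longrightarrow> group (Aut_group L P)"
  unfolding Aut_group_def by (rule group.subgroup_imp_group[OF group_BijGroup subgroup_Aut])

lemma carrier_Aut_group [simp]: "carrier (Aut_group L P) = Aut L P"
  by (simp add: Aut_group_def)

lemma mult_Aut_group_apply:
  "f \<in> Aut L P \<Longrightarrow> g \<in> Aut L P \<Longrightarrow> x \<in> univ P \<Longrightarrow> (f \<otimes>\<^bsub>Aut_group L P\<^esub> g) x = f (g x)"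
  using Aut_subset_Bij[of L P] by (auto simp: Aut_group_def BijGroup_def compose_def subset_iff)

abbreviation (input) conj_by ::
  "('f, 'r) language \<Rightarrow> ('f, 'r, 'p) struct \<Rightarrow> ('p \<Rightarrow> 'p) \<Rightarrow> ('p \<Rightarrow> 'p) \<Rightarrow> 'p \<Rightarrow> 'p" where
  "conj_by L P g h \<equiv> g \<otimes>\<^bsub>Aut_group L P\<^esub> h \<otimes>\<^bsub>Aut_group L P\<^esub> inv\<^bsub>Aut_group L P\<^esub> g"

text \<open>The conjugate is evaluated at \<open>g x\<close>, so that the inverse of
  \<open>g\<close> never has to be computed.\<close>

lemma conj_by_Aut:
  assumes P: "topological_structure L P" and g: "g \<in> Aut L P" and h: "h \<in> Aut L P"
  shows "conj_by L P g h \<in> Aut L P"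
    and "x \<in> univ P \<Longrightarrow> conj_by L P g h (g x) = g (h x)"
proof -
  interpret group "Aut_group L P" using P by (rule group_Aut_group)
  have gh: "g \<in> carrier (Aut_group L P)" "h \<in> carrier (Aut_group L P)"
    using g h by simp_all
  then have "conj_by L P g h \<in> carrier (Aut_group L P)"
    by (intro m_closed inv_closed)
  then show conj: "conj_by L P g h \<in> Aut L P" by simp
  assume x: "x \<in> univ P"
  have "conj_by L P g h \<otimes>\<^bsub>Aut_group L P\<^esub> g = g \<otimes>\<^bsub>Aut_group L P\<^esub> h"
    using gh by (simp add: m_assoc del: carrier_Aut_group)
  then show "conj_by L P g h (g x) = g (h x)"
    using mult_Aut_group_apply[OF conj g x] mult_Aut_group_apply[OF g h x] by simp
qed

section \<open>The topology of the automorphism group\<close>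

lemma Aut_topology_eq:
  assumes "topological_structure L P"
  shows "Aut_topology L P = subtopology (compact_open_topology (str_top P) (str_top P)) (Aut L P)"
proof -
  have "{f \<in> extensional (univ P). homeomorphic_map (str_top P) (str_top P) f} \<inter> Aut L P = Aut L P"
    using Aut_homeomorphic_map[OF assms] Aut_extensional[of _ L P] by blast
  then show ?thesis
    by (simp add: Aut_topology_def homeomorphism_group_topology_def subtopology_subtopology)
qed

lemma openin_compact_open_subbasic:
  "compactin X K \<Longrightarrow> openin Y U \<Longrightarrow>
    openin (compact_open_topology X Y) {f \<in> extensional (topspace X). continuous_map X Y f \<and> f ` K \<subseteq> U}"
  unfolding compact_open_topology_def by (rule topology_generated_by_Basis) blast

lemma openin_Aut_subbasic:
  assumes P: "topological_structure L P" and K: "closedin (str_top P) K" and U: "openin (str_top P) U"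
  shows "openin (Aut_topology L P) {f \<in> Aut L P. f ` K \<subseteq> U}"
proof -
  have "compactin (str_top P) K"
    using P K by (simp add: topological_structure_def closedin_compact_space)
  then have "openin (Aut_topology L P)
      ({f \<in> extensional (univ P). continuous_map (str_top P) (str_top P) f \<and> f ` K \<subseteq> U} \<inter> Aut L P)"
    unfolding Aut_topology_eq[OF P]
    using openin_compact_open_subbasic[OF _ U] by (blast intro: openin_subtopology_Int)
  moreover have "{f \<in> extensional (univ P). continuous_map (str_top P) (str_top P) f \<and> f ` K \<subseteq> U} \<inter> Aut L P
      = {f \<in> Aut L P. f ` K \<subseteq> U}"
    using Aut_extensional[of _ L P] Aut_continuous[of _ L P] by blast
  ultimately show ?thesis by simp
qed

lemma topspace_Aut_topology:
  assumes "topological_structure L P"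
  shows "topspace (Aut_topology L P) = Aut L P"
proof
  show "topspace (Aut_topology L P) \<subseteq> Aut L P" by (simp add: Aut_topology_def)
  have "openin (Aut_topology L P) {f \<in> Aut L P. f ` {} \<subseteq> {}}"
    using assms by (rule openin_Aut_subbasic) simp_all
  then show "Aut L P \<subseteq> topspace (Aut_topology L P)"
    using openin_subset by fastforce
qed

text \<open>The preimage of \<open>C\<close> equals \<open>D\<close> exactly if \<open>D\<close> is
  sent into \<open>C\<close> and the complement of \<open>D\<close> into the complement of
  \<open>C\<close>. Both are subbasic conditions, as clopen sets are at once compact and
  open.\<close>

lemma openin_Aut_vimage_eq:
  assumes P: "topological_structure L P" and C: "C \<in> clopens (str_top P)" and D: "D \<in> clopens (str_top P)"
  shows "openin (Aut_topology L P) {f \<in> Aut L P. {x \<in> univ P. f x \<in> C} = D}"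
proof -
  have D': "closedin (str_top P) D" "closedin (str_top P) (univ P - D)"
    and C': "openin (str_top P) C" "openin (str_top P) (univ P - C)"
    using C D clopens_diff[of D "str_top P"] clopens_diff[of C "str_top P"] by (simp_all add: clopens_def)
  have "openin (Aut_topology L P)
      ({f \<in> Aut L P. f ` D \<subseteq> C} \<inter> {f \<in> Aut L P. f ` (univ P - D) \<subseteq> univ P - C})"
    by (intro openin_Int openin_Aut_subbasic[OF P] D' C')
  moreover have "{x \<in> univ P. f x \<in> C} = D \<longleftrightarrow> f ` D \<subseteq> C \<and> f ` (univ P - D) \<subseteq> univ P - C"
    if "f \<in> Aut L P" for f
    using clopens_subset[OF D] Aut_in_univ[OF that] by auto
  then have "{f \<in> Aut L P. {x \<in> univ P. f x \<in> C} = D} =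
    {f \<in> Aut L P. f ` D \<subseteq> C} \<inter> {f \<in> Aut L P. f ` (univ P - D) \<subseteq> univ P - C}"
    by blast
  ultimately show ?thesis by simp
qed

lemma Aut_image_eq_iff:
  assumes f: "f \<in> Aut L P" and "C \<subseteq> univ P" "D \<subseteq> univ P"
  shows "f ` C = D \<longleftrightarrow> {x \<in> univ P. f x \<in> D} = C"
proof
  assume "f ` C = D"
  then show "{x \<in> univ P. f x \<in> D} = C"
    using assms by (auto simp: Aut_eq_iff[OF f] subset_iff)
next
  assume *: "{x \<in> univ P. f x \<in> D} = C"
  have "y \<in> f ` C" if "y \<in> D" for y
  proof -
    obtain x where "x \<in> univ P" "y = f x" using Aut_surj[OF f] \<open>D \<subseteq> univ P\<close> \<open>y \<in> D\<close> by blast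
    with * \<open>y \<in> D\<close> show ?thesis by blast
  qed
  with * show "f ` C = D" by blast
qed

lemma clopens_Aut_image:
  assumes P: "topological_structure L P" and f: "f \<in> Aut L P" and C: "C \<in> clopens (str_top P)"
  shows "f ` C \<in> clopens (str_top P)"
proof -
  have "openin (str_top P) C" "closedin (str_top P) C" using C by (simp_all add: clopens_def)
  then have "openin (str_top P) (f ` C)" "closedin (str_top P) (f ` C)"
    using homeomorphic_map_openness_eq[OF Aut_homeomorphic_map[OF P f]]
      homeomorphic_map_closedness_eq[OF Aut_homeomorphic_map[OF P f]] by blast+
  then show ?thesis by (simp add: clopens_def)
qed

lemma Aut_clopen_nbhd:
  assumes P: "topological_structure L P" and U: "openin (Aut_topology L P) U" and h: "h \<in> U"
  obtains \<C> where "finite \<C>" "\<C> \<subseteq> clopens (str_top P)"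
    "\<And>g. g \<in> Aut L P \<Longrightarrow> (\<And>C x. C \<in> \<C> \<Longrightarrow> x \<in> univ P \<Longrightarrow> g x \<in> C \<longleftrightarrow> h x \<in> C) \<Longrightarrow> g \<in> U"
proof -
  obtain V where V: "openin (compact_open_topology (str_top P) (str_top P)) V" "U = V \<inter> Aut L P"
    using U by (auto simp: Aut_topology_eq[OF P] openin_subtopology)
  have zd: "zero_dimensional_space (str_top P)" using P by (simp add: topological_structure_def)
  have hV: "h \<in> V" using h V(2) by blast
  show ?thesis
  proof (rule compact_open_clopen_nbhd[OF zd V(1) hV])
    fix \<C> assume \<C>: "finite \<C>" "\<C> \<subseteq> clopens (str_top P)"
      "\<And>g. g \<in> extensional (univ P) \<Longrightarrow> continuous_map (str_top P) (str_top P) g \<Longrightarrow>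
        (\<And>C x. C \<in> \<C> \<Longrightarrow> x \<in> univ P \<Longrightarrow> g x \<in> C \<longleftrightarrow> h x \<in> C) \<Longrightarrow> g \<in> V"
    show thesis
    proof (rule that[OF \<C>(1,2)])
      fix g assume g: "g \<in> Aut L P" "\<And>C x. C \<in> \<C> \<Longrightarrow> x \<in> univ P \<Longrightarrow> g x \<in> C \<longleftrightarrow> h x \<in> C"
      have "g \<in> V" using Aut_extensional[OF g(1)] Aut_continuous[OF g(1)] g(2) by (rule \<C>(3))
      with g(1) show "g \<in> U" by (simp add: V(2))
    qed
  qed
qed

text \<open>This is the automorphism of the clopen algebra induced by \<open>f\<close>, paired with
  its inverse. As for permutations of a countable set, recording the inverse is what makes the range
  closed: a limit of the preimage maps alone can come from a map that is not injective.\<close>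

definition clopen_action :: "'a topology \<Rightarrow> ('a \<Rightarrow> 'a) \<Rightarrow> 'a set \<Rightarrow> 'a set \<times> 'a set" where
  "clopen_action X f = (\<lambda>C\<in>clopens X. (f ` C, {x \<in> topspace X. f x \<in> C}))"

abbreviation clopen_action_space :: "'a topology \<Rightarrow> ('a set \<Rightarrow> 'a set \<times> 'a set) topology" where
  "clopen_action_space X \<equiv>
    product_topology (\<lambda>_. discrete_topology (clopens X \<times> clopens X)) (clopens X)"

lemma openin_clopen_action_cylinder:
  assumes "finite \<C>" "\<C> \<subseteq> clopens X"
  shows "openin (clopen_action_space X) {t \<in> topspace (clopen_action_space X). \<forall>C\<in>\<C>. t C = u C}"
proof (rule openin_finite_Ball[OF assms(1)])
  fix C assume "C \<in> \<C>"
  then have "continuous_map (clopen_action_space X) (discrete_topology (clopens X \<times> clopens X)) (\<lambda>t. t C)"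
    using assms(2) by (intro continuous_map_product_projection) blast
  from openin_continuous_map_preimage[OF this, of "{u C} \<inter> clopens X \<times> clopens X"]
  have "openin (clopen_action_space X)
    {t \<in> topspace (clopen_action_space X). t C \<in> {u C} \<inter> clopens X \<times> clopens X}" by simp
  moreover have "t C \<in> clopens X \<times> clopens X" if "t \<in> topspace (clopen_action_space X)" for t
    using that \<open>C \<in> \<C>\<close> assms(2) by (auto simp: PiE_iff)
  then have "{t \<in> topspace (clopen_action_space X). t C \<in> {u C} \<inter> clopens X \<times> clopens X} =
    {t \<in> topspace (clopen_action_space X). t C = u C}" by blast
  ultimately show "openin (clopen_action_space X) {t \<in> topspace (clopen_action_space X). t C = u C}"
    by simp
qed

lemma clopen_action_in_space:
  assumes "topological_structure L P" "f \<in> Aut L P"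
  shows "clopen_action (str_top P) f \<in> topspace (clopen_action_space (str_top P))"
  using clopens_Aut_image[OF assms] clopens_preimage[OF Aut_continuous[OF assms(2)]]
  by (simp add: clopen_action_def)

text \<open>Continuity holds since each coordinate takes a given value on an open set. Injectivity
  and openness use the preimage coordinates: they determine the points \<open>f x\<close>, and
  finitely many of them cut out a neighbourhood in the compact-open topology.\<close>

lemma embedding_map_clopen_action:
  assumes P: "topological_structure L P"
  shows "embedding_map (Aut_topology L P) (clopen_action_space (str_top P)) (clopen_action (str_top P))"
    (is "embedding_map ?A ?W ?e")
  unfolding embedding_map_def topspace_Aut_topology[OF P]
proof (rule bijective_open_imp_homeomorphic_map)
  have zd: "zero_dimensional_space (str_top P)" "Hausdorff_space (str_top P)"
    using P by (simp_all add: topological_structure_def)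
  have sub: "?e ` Aut L P \<subseteq> topspace ?W"
    using clopen_action_in_space[OF P] by blast
  then show "?e ` topspace ?A = topspace (subtopology ?W (?e ` Aut L P))"
    unfolding topspace_Aut_topology[OF P] topspace_subtopology by blast
  have "continuous_map ?A ?W ?e"
    unfolding continuous_map_componentwise
  proof (intro conjI ballI)
    show "?e ` topspace ?A \<subseteq> extensional (clopens (str_top P))"
      by (auto simp: clopen_action_def)
    fix C assume C: "C \<in> clopens (str_top P)"
    show "continuous_map ?A (discrete_topology (clopens (str_top P) \<times> clopens (str_top P))) (\<lambda>f. ?e f C)"
    proof (rule continuous_map_to_discrete_topology)
      show "(\<lambda>f. ?e f C) \<in> topspace ?A \<rightarrow> clopens (str_top P) \<times> clopens (str_top P)"
      proof
        fix f assume "f \<in> topspace ?A"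
        then have f: "f \<in> Aut L P" by (simp add: topspace_Aut_topology[OF P])
        then show "?e f C \<in> clopens (str_top P) \<times> clopens (str_top P)"
          using clopens_Aut_image[OF P f C] clopens_preimage[OF Aut_continuous[OF f] C] C
          by (simp add: clopen_action_def)
      qed
      fix q assume "q \<in> clopens (str_top P) \<times> clopens (str_top P)"
      then obtain D E where q: "q = (D, E)" and D: "D \<in> clopens (str_top P)" and E: "E \<in> clopens (str_top P)"
        by blast
      \<comment> \<open>The image condition becomes a preimage condition on \<open>D\<close>, the
        kind already known to be open.\<close>
      have "f ` C = D \<longleftrightarrow> {x \<in> univ P. f x \<in> D} = C" if "f \<in> Aut L P" for f
        using Aut_image_eq_iff[OF that clopens_subset[OF C] clopens_subset[OF D]] .
      then have "{f \<in> topspace ?A. ?e f C = q} =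
          {f \<in> Aut L P. {x \<in> univ P. f x \<in> D} = C} \<inter> {f \<in> Aut L P. {x \<in> univ P. f x \<in> C} = E}"
        using C by (auto simp: clopen_action_def q topspace_Aut_topology[OF P])
      then show "openin ?A {f \<in> topspace ?A. ?e f C = q}"
        using openin_Aut_vimage_eq[OF P] C D E by (simp add: openin_Int)
    qed
  qed
  then show "continuous_map ?A (subtopology ?W (?e ` Aut L P)) ?e"
    by (simp add: continuous_map_in_subtopology topspace_Aut_topology[OF P])
  show "inj_on ?e (topspace ?A)"
    unfolding topspace_Aut_topology[OF P]
  proof (rule inj_onI)
    fix f g assume f: "f \<in> Aut L P" and g: "g \<in> Aut L P" and eq: "?e f = ?e g"
    show "f = g"
    proof (rule extensionalityI[OF Aut_extensional[OF f] Aut_extensional[OF g]])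
      fix x assume x: "x \<in> univ P"
      show "f x = g x"
      proof (rule clopen_separation[OF zd Aut_in_univ[OF f x] Aut_in_univ[OF g x]])
        fix C assume C: "C \<in> clopens (str_top P)" "f x \<in> C"
        then have "{x \<in> univ P. f x \<in> C} = {x \<in> univ P. g x \<in> C}"
          using fun_cong[OF eq, of C] by (simp add: clopen_action_def)
        with C x show "g x \<in> C" by blast
      qed
    qed
  qed
  show "open_map ?A (subtopology ?W (?e ` Aut L P)) ?e"
    unfolding open_map_def
  proof (intro allI impI)
    fix U assume U: "openin ?A U"
    then have UA: "U \<subseteq> Aut L P" using openin_subset topspace_Aut_topology[OF P] by blast
    show "openin (subtopology ?W (?e ` Aut L P)) (?e ` U)"
    proof (subst openin_subopen, rule ballI)
      fix t assume "t \<in> ?e ` U"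
      then obtain h where h: "h \<in> U" "t = ?e h" by blast
      show "\<exists>T. openin (subtopology ?W (?e ` Aut L P)) T \<and> t \<in> T \<and> T \<subseteq> ?e ` U"
      proof (rule Aut_clopen_nbhd[OF P U h(1)])
        fix \<C> assume \<C>: "finite \<C>" "\<C> \<subseteq> clopens (str_top P)"
          "\<And>g. g \<in> Aut L P \<Longrightarrow> (\<And>C x. C \<in> \<C> \<Longrightarrow> x \<in> univ P \<Longrightarrow> g x \<in> C \<longleftrightarrow> h x \<in> C) \<Longrightarrow> g \<in> U"
        define T where "T = {t \<in> topspace ?W. \<forall>C\<in>\<C>. t C = ?e h C}"
        have "openin (subtopology ?W (?e ` Aut L P)) (T \<inter> ?e ` Aut L P)"
          unfolding T_def by (intro openin_subtopology_Int openin_clopen_action_cylinder \<C>(1,2))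
        moreover have "?e h \<in> T \<inter> ?e ` Aut L P"
          using h(1) UA clopen_action_in_space[OF P] unfolding T_def by blast
        moreover have "?e g \<in> ?e ` U" if g: "g \<in> Aut L P" "?e g \<in> T" for g
        proof (rule imageI, rule \<C>(3)[OF g(1)])
          fix C x assume C: "C \<in> \<C>" and x: "x \<in> univ P"
          have "?e g C = ?e h C" using g(2) C by (simp add: T_def)
          then have "{x \<in> univ P. g x \<in> C} = {x \<in> univ P. h x \<in> C}"
            using C \<C>(2) by (simp add: clopen_action_def subset_iff)
          with x show "g x \<in> C \<longleftrightarrow> h x \<in> C" by blast
        qed
        ultimately show ?thesis unfolding h(2) by (intro exI[of _ "T \<inter> ?e ` Aut L P"]) blast
      qed
    qed
  qed
qed

text \<open>Stone duality: a point of the closure is a Boolean automorphism of the clopen algebra,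
  the second components providing the inverse.\<close>

lemma closedin_clopen_action_image:
  assumes P: "topological_structure L P"
  shows "closedin (clopen_action_space (str_top P)) (clopen_action (str_top P) ` Aut L P)"
    (is "closedin ?W (?e ` _)")
proof -
  let ?K = "clopens (str_top P)"
  have top: "compact_space (str_top P)" "zero_dimensional_space (str_top P)" "Hausdorff_space (str_top P)"
    using P by (simp_all add: topological_structure_def)
  have sub: "?e ` Aut L P \<subseteq> topspace ?W"
    using clopen_action_in_space[OF P] by blast
  have "T \<in> ?e ` Aut L P" if T: "T \<in> ?W closure_of (?e ` Aut L P)" for T
  proof -
    define a b where "a C = fst (T C)" and "b C = snd (T C)" for C
    have TW: "T \<in> topspace ?W" using T by (simp add: in_closure_of)
    have TK: "T C \<in> ?K \<times> ?K" if "C \<in> ?K" for C using TW that by (auto simp: PiE_iff)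
    have aK: "a C \<in> ?K" and bK: "b C \<in> ?K" if "C \<in> ?K" for C
      using TK[OF that] by (auto simp: a_def b_def)
    \<comment> \<open>On any finite family of clopen sets, \<open>T\<close> agrees with a genuine
      automorphism. Everything below about \<open>a\<close> and \<open>b\<close> is read off from
      such an \<open>h\<close>, taken for the finitely many sets at issue.\<close>
    have approx: "\<exists>h\<in>Aut L P. \<forall>C\<in>\<C>. h ` C = a C \<and> {x \<in> univ P. h x \<in> C} = b C"
      if \<C>: "finite \<C>" "\<C> \<subseteq> ?K" for \<C>
    proof -
      define N where "N = {t \<in> topspace ?W. \<forall>C\<in>\<C>. t C = T C}"
      have "T \<in> N \<and> openin ?W N"
        unfolding N_def using TW openin_clopen_action_cylinder[OF \<C>] by simp
      from T[unfolded in_closure_of, THEN conjunct2, rule_format, OF this]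
      obtain h where h: "h \<in> Aut L P" "?e h \<in> N" by (elim exE conjE imageE) simp
      have "h ` C = a C \<and> {x \<in> univ P. h x \<in> C} = b C" if "C \<in> \<C>" for C
      proof -
        have "T C = ?e h C" using h(2) that by (simp add: N_def)
        then show ?thesis using that \<C>(2) by (simp add: a_def b_def clopen_action_def subset_iff)
      qed
      with h(1) show ?thesis by blast
    qed
    have in_a: "h x \<in> a C \<longleftrightarrow> x \<in> C" if "h \<in> Aut L P" "h ` C = a C" "C \<in> ?K" "x \<in> univ P" for h C x
      using that clopens_subset[OF that(3)] Aut_eq_iff[OF that(1)] by (auto simp flip: that(2))
    \<comment> \<open>The limit map has to satisfy that \<open>b C\<close> is the preimage of
      \<open>C\<close>. This prescribes the clopen neighbourhoods of \<open>f x\<close>, and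
      \<open>h x\<close> realizes any finite part of the prescription.\<close>
    have "\<exists>!y. y \<in> univ P \<and> (\<forall>C\<in>?K. y \<in> C \<longleftrightarrow> x \<in> b C)" if x: "x \<in> univ P" for x
    proof (rule ex1_point_of_clopen_ultrafilter[OF top])
      fix \<C> assume "finite \<C>" "\<C> \<subseteq> ?K"
      from approx[OF this] obtain h where h: "h \<in> Aut L P" "\<forall>C\<in>\<C>. h ` C = a C \<and> {x \<in> univ P. h x \<in> C} = b C"
        by (elim bexE)
      have "h x \<in> C \<longleftrightarrow> x \<in> b C" if "C \<in> \<C>" for C
      proof -
        have "{x \<in> univ P. h x \<in> C} = b C" using h(2) that by simp
        then show ?thesis using x by blast
      qed
      then show "\<exists>y\<in>univ P. \<forall>C\<in>\<C>. y \<in> C \<longleftrightarrow> x \<in> b C"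
        using Aut_in_univ[OF h(1) x] by blast
    qed
    then obtain f where f: "\<And>x. x \<in> univ P \<Longrightarrow> f x \<in> univ P \<and> (\<forall>C\<in>?K. f x \<in> C \<longleftrightarrow> x \<in> b C)"
      by metis
    \<comment> \<open>The same construction with \<open>a\<close> gives the candidate
      \<open>g\<close> for the inverse of \<open>f\<close>; here the finite parts are realized by
      the point that \<open>h\<close> sends to \<open>y\<close>.\<close>
    have "\<exists>!x. x \<in> univ P \<and> (\<forall>C\<in>?K. x \<in> C \<longleftrightarrow> y \<in> a C)" if y: "y \<in> univ P" for y
    proof (rule ex1_point_of_clopen_ultrafilter[OF top])
      fix \<C> assume \<C>: "finite \<C>" "\<C> \<subseteq> ?K"
      from approx[OF this] obtain h where h: "h \<in> Aut L P" "\<forall>C\<in>\<C>. h ` C = a C \<and> {x \<in> univ P. h x \<in> C} = b C"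
        by (elim bexE)
      obtain x where x: "x \<in> univ P" "y = h x" using Aut_surj[OF h(1) y] .
      have "x \<in> C \<longleftrightarrow> y \<in> a C" if "C \<in> \<C>" for C
        using in_a[OF h(1) _ _ x(1), of C] h(2) that \<C>(2) x(2) by (simp add: subset_iff)
      with x(1) show "\<exists>x\<in>univ P. \<forall>C\<in>\<C>. x \<in> C \<longleftrightarrow> y \<in> a C" by blast
    qed
    then obtain g where g: "\<And>y. y \<in> univ P \<Longrightarrow> g y \<in> univ P \<and> (\<forall>C\<in>?K. g y \<in> C \<longleftrightarrow> y \<in> a C)"
      by metis
    have fP: "f x \<in> univ P" and fC: "C \<in> ?K \<Longrightarrow> f x \<in> C \<longleftrightarrow> x \<in> b C" if "x \<in> univ P" for x C
      using f[OF that] by simp_all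
    have gP: "g x \<in> univ P" and gC: "C \<in> ?K \<Longrightarrow> g x \<in> C \<longleftrightarrow> x \<in> a C" if "x \<in> univ P" for x C
      using g[OF that] by simp_all
    \<comment> \<open>Both identities involve applying \<open>a\<close> or \<open>b\<close> twice,
      so \<open>h\<close> must agree with \<open>T\<close> at \<open>C\<close>, \<open>a C\<close>
      and \<open>b C\<close> simultaneously.\<close>
    have ba: "b (a C) = C" and ab: "a (b C) = C" if C: "C \<in> ?K" for C
    proof -
      obtain h where h: "h \<in> Aut L P" "\<forall>D\<in>{C, a C, b C}. h ` D = a D \<and> {x \<in> univ P. h x \<in> D} = b D"
        using approx[of "{C, a C, b C}"] C aK bK by (elim bexE[rotated]) simp_all
      have CP: "C \<subseteq> univ P" "a C \<subseteq> univ P" "b C \<subseteq> univ P" using clopens_subset C aK bK by blast+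
      have hC: "h ` C = a C" "{x \<in> univ P. h x \<in> C} = b C" "{x \<in> univ P. h x \<in> a C} = b (a C)"
        "h ` b C = a (b C)" using h(2) by simp_all
      show "b (a C) = C"
        using iffD1[OF Aut_image_eq_iff[OF h(1) CP(1,2)] hC(1)] hC(3) by (rule trans[OF sym, rotated])
      show "a (b C) = C"
        using hC(4) iffD2[OF Aut_image_eq_iff[OF h(1) CP(3,1)] hC(2)] by (rule trans[OF sym])
    qed
    have gf: "g (f x) = x" if x: "x \<in> univ P" for x
      using ba aK x by (intro clopen_separation[OF top(2,3) gP[OF fP[OF x]] x]) (simp add: gC fC fP)
    have fg: "f (g y) = y" if y: "y \<in> univ P" for y
      using ab bK y by (intro clopen_separation[OF top(2,3) fP[OF gP[OF y]] y]) (simp add: gC fC gP)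
    have bij: "bij_betw f (univ P) (univ P)"
      using gf fg fP gP by (intro bij_betw_byWitness[where f' = g]) auto
    have cont: "continuous_map (str_top P) (str_top P) f"
      unfolding continuous_map_def
    proof (intro conjI allI impI)
      show "f \<in> univ P \<rightarrow> univ P" using fP by blast
      fix U assume U: "openin (str_top P) U"
      show "openin (str_top P) {x \<in> univ P. f x \<in> U}"
      proof (subst openin_subopen, rule ballI)
        fix x assume x: "x \<in> {x \<in> univ P. f x \<in> U}"
        then obtain C where C: "C \<in> ?K" "f x \<in> C" "C \<subseteq> U"
          using clopen_nbhd[OF top(2) U, of "f x"] by blast
        have "openin (str_top P) (b C)" using bK[OF C(1)] by (simp add: clopens_def)
        moreover have "x \<in> b C" using x C fC by blast
        moreover have "b C \<subseteq> {x \<in> univ P. f x \<in> U}"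
          using clopens_subset[OF bK[OF C(1)]] fC C(1,3) by blast
        ultimately show "\<exists>V. openin (str_top P) V \<and> x \<in> V \<and> V \<subseteq> {x \<in> univ P. f x \<in> U}" by blast
      qed
    qed
    have approx_f: "\<exists>h\<in>Aut L P. \<forall>C\<in>\<C>. \<forall>x\<in>univ P. h x \<in> C \<longleftrightarrow> f x \<in> C"
      if \<C>: "finite \<C>" "\<C> \<subseteq> ?K" for \<C>
    proof -
      from approx[OF \<C>] obtain h where h: "h \<in> Aut L P" "\<forall>C\<in>\<C>. h ` C = a C \<and> {x \<in> univ P. h x \<in> C} = b C"
        by (elim bexE)
      have "h x \<in> C \<longleftrightarrow> f x \<in> C" if "C \<in> \<C>" "x \<in> univ P" for C x
      proof -
        have "{x \<in> univ P. h x \<in> C} = b C" using h(2) that by simp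
        with that \<C>(2) show ?thesis by (auto simp: fC subset_iff)
      qed
      with h(1) show ?thesis by blast
    qed
    have fun_f: "str_fun P F (\<lambda>i\<in>{..<fun_arity L F}. f (x i)) = f (str_fun P F x)"
      if F: "F \<in> fun_syms L" and x: "x \<in> tuples (fun_arity L F) (univ P)" for F x
    proof -
      let ?n = "fun_arity L F"
      define y where "y = (\<lambda>i\<in>{..<?n}. f (x i))"
      have xi: "x i \<in> univ P" if "i < ?n" for i using x that by auto
      have y: "y \<in> tuples ?n (univ P)" using xi fP by (auto simp: y_def)
      have Fx: "str_fun P F x \<in> univ P" by (rule str_fun_in_univ[OF P F x])
      have Fcont: "continuous_map (product_topology (\<lambda>_. str_top P) {..<?n}) (str_top P) (str_fun P F)"
        using P F by (simp add: topological_structure_def)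
      have "str_fun P F y = f (str_fun P F x)"
      proof (rule clopen_separation[OF top(2,3) str_fun_in_univ[OF P F y] fP[OF Fx]], rule ccontr)
        fix D assume D: "D \<in> ?K" "str_fun P F y \<in> D" "f (str_fun P F x) \<notin> D"
        \<comment> \<open>If the two values differed, \<open>D\<close> would separate them.
          Approximations \<open>h\<close> that agree with \<open>f\<close> on \<open>D\<close> put
          the tuples of values of \<open>h\<close> into the closed set \<open>R\<close>, where the
          function avoids \<open>D\<close>; their limit \<open>y\<close> would lie in
          \<open>R\<close> as well.\<close>
        define R where "R = {z \<in> tuples ?n (univ P). str_fun P F z \<in> univ P - D}"
        have "closedin (product_topology (\<lambda>_. str_top P) {..<?n}) R"
          using closedin_continuous_map_preimage[OF Fcont, of "univ P - D"] clopens_diff[OF D(1)]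
          by (simp add: R_def clopens_def)
        then have "y \<in> R"
        proof (rule closedin_product_clopen_limit[OF top(2) _ finite_lessThan y])
          fix \<C> assume \<C>: "finite \<C>" "\<C> \<subseteq> ?K"
          then have D\<C>: "finite (insert D \<C>)" "insert D \<C> \<subseteq> ?K" using D(1) by simp_all
          from approx_f[OF this] obtain h where h: "h \<in> Aut L P"
            "\<forall>C\<in>insert D \<C>. \<forall>x\<in>univ P. h x \<in> C \<longleftrightarrow> f x \<in> C" by (elim bexE)
          define z where "z = (\<lambda>i\<in>{..<?n}. h (x i))"
          have "z \<in> tuples ?n (univ P)" using xi Aut_in_univ[OF h(1)] by (auto simp: z_def)
          moreover have "str_fun P F z = h (str_fun P F x)"
            unfolding z_def by (rule epimorphism_fun[OF Aut_epimorphism[OF h(1)] F x])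
          ultimately have "z \<in> R" using h(2) Fx D(3) Aut_in_univ[OF h(1) Fx] by (simp add: R_def)
          moreover have "z i \<in> C" if "i < ?n" "C \<in> \<C>" "y i \<in> C" for i C
            using that h(2) xi by (simp add: z_def y_def)
          ultimately show "\<exists>z\<in>R. \<forall>i\<in>{..<?n}. \<forall>C\<in>\<C>. y i \<in> C \<longrightarrow> z i \<in> C" by blast
        qed
        then show False using D(2) by (simp add: R_def)
      qed
      then show ?thesis by (simp add: y_def)
    qed
    have rel_f: "x \<in> str_rel P q \<longleftrightarrow>
        (\<exists>y\<in>tuples (rel_arity L q) (univ P). (\<forall>i<rel_arity L q. f (y i) = x i) \<and> y \<in> str_rel P q)"
      (is "_ \<longleftrightarrow> ?R") if q: "q \<in> rel_syms L" and x: "x \<in> tuples (rel_arity L q) (univ P)" for q x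
    proof
      let ?n = "rel_arity L q"
      have closed: "closedin (product_topology (\<lambda>_. str_top P) {..<?n}) (str_rel P q)"
        using P q by (simp add: topological_structure_def)
      have xi: "x i \<in> univ P" if "i < ?n" for i using x that by auto
      {
        assume xq: "x \<in> str_rel P q"
        define y where "y = (\<lambda>i\<in>{..<?n}. g (x i))"
        have y: "y \<in> tuples ?n (univ P)" using xi gP by (auto simp: y_def)
        \<comment> \<open>The lifts \<open>z\<close> of \<open>x\<close> along approximations
          \<open>h\<close> approximate \<open>y\<close>: if \<open>y i\<close> lies in
          \<open>C\<close>, then \<open>x i = h (z i)\<close> lies in \<open>a C\<close>, which is
          the image of \<open>C\<close> under \<open>h\<close>.\<close>
        have "y \<in> str_rel P q"
        proof (rule closedin_product_clopen_limit[OF top(2) closed finite_lessThan y])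
          fix \<C> assume \<C>: "finite \<C>" "\<C> \<subseteq> ?K"
          from approx[OF this] obtain h where h: "h \<in> Aut L P"
            "\<forall>C\<in>\<C>. h ` C = a C \<and> {x \<in> univ P. h x \<in> C} = b C" by (elim bexE)
          obtain z where z: "z \<in> tuples ?n (univ P)" "\<forall>i<?n. h (z i) = x i" "z \<in> str_rel P q"
            using epimorphism_rel[OF Aut_epimorphism[OF h(1)] q x] xq by blast
          have "z i \<in> C" if "i < ?n" "C \<in> \<C>" "y i \<in> C" for i C
          proof -
            have C: "C \<in> ?K" "h ` C = a C" and zi: "z i \<in> univ P" using that \<C>(2) h(2) z(1) by auto
            have "h (z i) \<in> a C" using that C(1) xi z(2) by (simp add: y_def gC)
            then show ?thesis using in_a[OF h(1) C(2,1) zi] by simp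
          qed
          with z(3) show "\<exists>z\<in>str_rel P q. \<forall>i\<in>{..<?n}. \<forall>C\<in>\<C>. y i \<in> C \<longrightarrow> z i \<in> C" by blast
        qed
        moreover have "\<forall>i<?n. f (y i) = x i" using fg xi by (simp add: y_def)
        ultimately show ?R using y by blast
      }
      assume ?R
      then obtain y where y: "y \<in> tuples ?n (univ P)" "\<forall>i<?n. f (y i) = x i" "y \<in> str_rel P q" by blast
      \<comment> \<open>Conversely, \<open>x\<close> is a limit of the images of \<open>y\<close>
        under approximations \<open>h\<close>, and these images satisfy the relation because each
        \<open>h\<close> is an epimorphism.\<close>
      show "x \<in> str_rel P q"
      proof (rule closedin_product_clopen_limit[OF top(2) closed finite_lessThan x])
        fix \<C> assume \<C>: "finite \<C>" "\<C> \<subseteq> ?K"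
        from approx_f[OF this] obtain h where h: "h \<in> Aut L P"
          "\<forall>C\<in>\<C>. \<forall>x\<in>univ P. h x \<in> C \<longleftrightarrow> f x \<in> C" by (elim bexE)
        have "(\<lambda>i\<in>{..<?n}. h (y i)) \<in> str_rel P q"
          by (rule epimorphism_rel_image[OF Aut_epimorphism[OF h(1)] q y(1,3)])
        moreover have "h (y i) \<in> C" if "i < ?n" "C \<in> \<C>" "x i \<in> C" for i C
        proof -
          have "y i \<in> univ P" using y(1) that(1) by auto
          then show ?thesis using that h(2) y(2) by simp
        qed
        ultimately show "\<exists>z\<in>str_rel P q. \<forall>i\<in>{..<?n}. \<forall>C\<in>\<C>. x i \<in> C \<longrightarrow> z i \<in> C"
          by (intro bexI[of _ "\<lambda>i\<in>{..<?n}. h (y i)"]) simp_all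
      qed
    qed
    have "epimorphism L P P f"
      unfolding epimorphism_def
      using cont bij_betw_imp_surj_on[OF bij] fun_f rel_f by (intro conjI ballI)
    with bij have "struct_iso L P P f" by (simp add: struct_iso_def)
    then have f': "restrict f (univ P) \<in> Aut L P" by (rule restrict_in_Aut[OF P])
    have "?e (restrict f (univ P)) C = T C" if C: "C \<in> ?K" for C
    proof -
      have "restrict f (univ P) ` C = a C"
      proof (subst Aut_image_eq_iff[OF f' clopens_subset[OF C] clopens_subset[OF aK[OF C]]])
        show "{x \<in> univ P. restrict f (univ P) x \<in> a C} = C"
          using clopens_subset[OF C] by (auto simp: fC aK[OF C] ba[OF C])
      qed
      moreover have "{x \<in> univ P. restrict f (univ P) x \<in> C} = b C"
        using clopens_subset[OF bK[OF C]] by (auto simp: fC C)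
      ultimately show ?thesis using C by (simp add: clopen_action_def a_def b_def)
    qed
    then have "T = ?e (restrict f (univ P))"
      using TW by (intro extensionalityI[of _ ?K]) (simp_all add: clopen_action_def PiE_iff)
    with f' show ?thesis by blast
  qed
  then show ?thesis using sub by (auto simp: closure_of_subset_eq[symmetric])
qed

text \<open>A countable product of discrete spaces is completely metrizable, and this passes to the
  closed copy of the automorphism group inside it.\<close>

lemma completely_metrizable_Aut_topology:
  assumes P: "topological_structure L P"
  shows "completely_metrizable_space (Aut_topology L P)"
proof -
  let ?W = "clopen_action_space (str_top P)" and ?e = "clopen_action (str_top P)"
  have "countable (clopens (str_top P))"
    using P by (intro countable_clopens) (simp_all add: topological_structure_def)
  then have "completely_metrizable_space ?W"
    unfolding completely_metrizable_space_product_topology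
    by (simp add: completely_metrizable_space_discrete_topology)
  then have "completely_metrizable_space (subtopology ?W (?e ` Aut L P))"
    using closedin_clopen_action_image[OF P] by (rule completely_metrizable_space_closedin)
  moreover have "Aut_topology L P homeomorphic_space subtopology ?W (?e ` Aut L P)"
    using embedding_map_clopen_action[OF P] homeomorphic_map_imp_homeomorphic_space
    unfolding embedding_map_def topspace_Aut_topology[OF P] by blast
  ultimately show ?thesis
    using homeomorphic_completely_metrizable_space by blast
qed

section \<open>Finite quotients of the limit\<close>

abbreviation graph_image :: "('f, 'r, 'p) struct \<Rightarrow> ('p \<Rightarrow> 'a) \<Rightarrow> ('p \<Rightarrow> 'p) \<Rightarrow> ('a \<times> 'a) set" where
  "graph_image P \<phi> h \<equiv> (\<lambda>x. (\<phi> x, \<phi> (h x))) ` univ P"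

lemma map_prod_graph_image: "map_prod \<alpha> \<alpha> ` graph_image P \<phi> h = graph_image P (\<alpha> \<circ> \<phi>) h"
  by (simp add: image_image)

lemma graph_image_subset:
  "epimorphism L P A \<phi> \<Longrightarrow> h \<in> Aut L P \<Longrightarrow> graph_image P \<phi> h \<subseteq> univ A \<times> univ A"
  using epimorphism_in_univ[of L P A \<phi>] Aut_in_univ[of h L P] by blast

text \<open>Reparametrize the graph by \<open>x \<mapsto> g x\<close>. Through this identity,
  homogeneity of the limit, a statement on epimorphisms, becomes one on conjugates.\<close>

lemma graph_image_conj_by:
  assumes "topological_structure L P" "g \<in> Aut L P" "h \<in> Aut L P"
  shows "graph_image P \<phi> (conj_by L P g h) = graph_image P (\<phi> \<circ> g) h"
proof -
  have "graph_image P \<phi> (conj_by L P g h) = (\<lambda>x. (\<phi> x, \<phi> (conj_by L P g h x))) ` g ` univ P"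
    using Aut_bij_betw[OF assms(2)] by (simp add: bij_betw_def)
  then show ?thesis
    using conj_by_Aut(2)[OF assms] by (simp add: image_image cong: image_cong)
qed

text \<open>The relation on a member of the family is forced to be the image of a graph, so members
  are parametrized by a quotient map and an element of \<open>H\<close>.\<close>

lemma induced_family_eq:
  fixes L :: "('f, 'r) language" and \<G> :: "('f, 'r, 'a) struct set" and P :: "('f, 'r, 'p) struct"
  assumes s: "s \<notin> rel_syms L" and H: "H \<subseteq> Aut L P"
  shows "induced_family L s \<G> P H =
    {expand s A (graph_image P \<phi> h) | A \<phi> h. A \<in> \<G> \<and> epimorphism L P A \<phi> \<and> h \<in> H}"
proof -
  have graph: "graph_on (univ P) h = (\<lambda>x. (x, h x)) ` univ P" if "h \<in> H" for h
    using Aut_in_univ[of h L P] that H by (auto simp: graph_on_def)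
  have iff: "epimorphism (add_binary L s) (expand s P (graph_on (univ P) h)) (expand s A S) \<phi> \<longleftrightarrow>
      epimorphism L P A \<phi> \<and> graph_image P \<phi> h = S"
    if "h \<in> H" "S \<subseteq> univ A \<times> univ A" for h \<phi> S and A :: "('f, 'r, 'a) struct"
  proof -
    have "graph_on (univ P) h \<subseteq> univ P \<times> univ P" by (auto simp: graph_on_def)
    from epimorphism_expand[OF s this that(2)] show ?thesis
      by (simp add: graph[OF that(1)] image_image)
  qed
  show ?thesis
    unfolding induced_family_def
  proof (intro equalityI subsetI)
    fix E assume "E \<in> {expand s A S | A S. A \<in> \<G> \<and> S \<subseteq> univ A \<times> univ A \<and>
        (\<exists>\<phi>. epimorphism L P A \<phi> \<and>
           (\<exists>f\<in>H. epimorphism (add_binary L s) (expand s P (graph_on (univ P) f)) (expand s A S) \<phi>))}"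
    then obtain A S \<phi> f where E: "E = expand s A S" "A \<in> \<G>" "S \<subseteq> univ A \<times> univ A" "epimorphism L P A \<phi>"
      "f \<in> H" "epimorphism (add_binary L s) (expand s P (graph_on (univ P) f)) (expand s A S) \<phi>"
      by (elim CollectE exE conjE bexE)
    then have "graph_image P \<phi> f = S" by (simp add: iff)
    with E show "E \<in> {expand s A (graph_image P \<phi> h) | A \<phi> h. A \<in> \<G> \<and> epimorphism L P A \<phi> \<and> h \<in> H}"
      by blast
  next
    fix E assume "E \<in> {expand s A (graph_image P \<phi> h) | A \<phi> h. A \<in> \<G> \<and> epimorphism L P A \<phi> \<and> h \<in> H}"
    then obtain A \<phi> f where E: "E = expand s A (graph_image P \<phi> f)" "A \<in> \<G>" "epimorphism L P A \<phi>" "f \<in> H"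
      by (elim CollectE exE conjE)
    have S: "graph_image P \<phi> f \<subseteq> univ A \<times> univ A"
      by (rule graph_image_subset[OF E(3) subsetD[OF H E(4)]])
    then have "epimorphism (add_binary L s) (expand s P (graph_on (univ P) f))
        (expand s A (graph_image P \<phi> f)) \<phi>"
      using E(3,4) by (simp add: iff)
    with E S show "E \<in> {expand s A S | A S. A \<in> \<G> \<and> S \<subseteq> univ A \<times> univ A \<and>
        (\<exists>\<phi>. epimorphism L P A \<phi> \<and>
           (\<exists>f\<in>H. epimorphism (add_binary L s) (expand s P (graph_on (univ P) f)) (expand s A S) \<phi>))}"
      by (intro CollectI exI conjI) (rule refl E S bexI | assumption)+
  qed
qed

lemma finite_structure_discrete:
  "topological_structure L A \<Longrightarrow> finite (univ A) \<Longrightarrow> str_top A = discrete_topology (univ A)"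
  by (intro finite_topspace_imp_discrete_topology) (simp_all add: topological_structure_def)

lemma clopens_fibre:
  assumes "topological_structure L A" "finite (univ A)" "epimorphism L P A \<phi>" "a \<in> univ A"
  shows "{x \<in> univ P. \<phi> x = a} \<in> clopens (str_top P)"
proof -
  have "{a} \<in> clopens (str_top A)"
    using assms(4) by (subst finite_structure_discrete[OF assms(1,2)]) (simp add: clopens_def)
  from clopens_preimage[OF epimorphism_continuous[OF assms(3)] this] show ?thesis by simp
qed

text \<open>If \<open>k\<close> and \<open>f\<close> have the same preimages of the fibres of
  \<open>\<phi>\<close>, then \<open>\<phi> \<circ> k\<close> and \<open>\<phi> \<circ> f\<close>
  agree on \<open>P\<close>, and so do the graph images. There are finitely many fibres, all
  clopen.\<close>

lemma openin_Aut_graph_image_eq: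
  assumes P: "topological_structure L P" and A: "topological_structure L A" "finite (univ A)"
    and \<phi>: "epimorphism L P A \<phi>"
  shows "openin (Aut_topology L P) {k \<in> Aut L P. graph_image P \<phi> k = S}"
proof (subst openin_subopen, rule ballI)
  fix f assume f: "f \<in> {k \<in> Aut L P. graph_image P \<phi> k = S}"
  then have fA: "f \<in> Aut L P" by simp
  define F where "F a = {x \<in> univ P. \<phi> x = a}" for a
  define T where "T = {k \<in> topspace (Aut_topology L P). \<forall>a\<in>univ A. {x \<in> univ P. k x \<in> F a} = {x \<in> univ P. f x \<in> F a}}"
  have F: "F a \<in> clopens (str_top P)" if "a \<in> univ A" for a
    unfolding F_def by (rule clopens_fibre[OF A \<phi> that])
  have T1: "openin (Aut_topology L P) T"
    unfolding T_def
  proof (rule openin_finite_Ball[OF A(2)])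
    fix a assume a: "a \<in> univ A"
    have "{x \<in> univ P. f x \<in> F a} \<in> clopens (str_top P)"
      by (rule clopens_preimage[OF Aut_continuous[OF fA] F[OF a]])
    from openin_Aut_vimage_eq[OF P F[OF a] this]
    show "openin (Aut_topology L P)
        {k \<in> topspace (Aut_topology L P). {x \<in> univ P. k x \<in> F a} = {x \<in> univ P. f x \<in> F a}}"
      by (simp add: topspace_Aut_topology[OF P])
  qed
  have T2: "f \<in> T" using f by (simp add: T_def topspace_Aut_topology[OF P])
  have T3: "k \<in> {k \<in> Aut L P. graph_image P \<phi> k = S}" if "k \<in> T" for k
  proof -
    have k: "k \<in> Aut L P" "\<And>a. a \<in> univ A \<Longrightarrow> {x \<in> univ P. k x \<in> F a} = {x \<in> univ P. f x \<in> F a}"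
      using that by (simp_all add: T_def topspace_Aut_topology[OF P])
    have "\<phi> (k x) = \<phi> (f x)" if x: "x \<in> univ P" for x
    proof -
      have fx: "f x \<in> univ P" by (rule Aut_in_univ[OF fA x])
      have "{y \<in> univ P. k y \<in> F (\<phi> (f x))} = {y \<in> univ P. f y \<in> F (\<phi> (f x))}"
        by (rule k(2)[OF epimorphism_in_univ[OF \<phi> fx]])
      moreover have "x \<in> {y \<in> univ P. f y \<in> F (\<phi> (f x))}" using x fx by (simp add: F_def)
      ultimately have "k x \<in> F (\<phi> (f x))" by blast
      then show ?thesis by (simp add: F_def)
    qed
    then have "graph_image P \<phi> k = graph_image P \<phi> f" by (simp cong: image_cong)
    with f k(1) show ?thesis by simp
  qed
  show "\<exists>T. openin (Aut_topology L P) T \<and> f \<in> T \<and> T \<subseteq> {k \<in> Aut L P. graph_image P \<phi> k = S}"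
    by (rule exI[of _ T]) (intro conjI T1 T2 subsetI T3)
qed

section \<open>Consequences of the limit axioms\<close>

text \<open>Apply (L2) to the map that sends a point to the set of members of \<open>\<C>\<close>
  containing it.\<close>

lemma limit_epimorphism_refines:
  fixes P :: "('f, 'r, 'p) struct"
  assumes lim: "projective_Fraisse_limit L \<G> P"
    and \<C>: "finite \<C>" "\<C> \<subseteq> clopens (str_top P)"
  obtains A \<phi> where "A \<in> \<G>" "epimorphism L P A \<phi>"
    "\<And>C x y. C \<in> \<C> \<Longrightarrow> x \<in> univ P \<Longrightarrow> y \<in> univ P \<Longrightarrow> \<phi> x = \<phi> y \<Longrightarrow> x \<in> C \<longleftrightarrow> y \<in> C"
proof -
  \<comment> \<open>(L2) speaks of finite sets of naturals, so the subfamilies of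
    \<open>\<C>\<close> are coded by numbers.\<close>
  obtain e :: "'p set set \<Rightarrow> nat" where e: "inj_on e (Pow \<C>)"
    using finite_imp_inj_to_nat_seg[of "Pow \<C>"] \<C>(1) by auto
  define F where "F x = e {C \<in> \<C>. x \<in> C}" for x
  have F_eq: "F x = e \<D> \<longleftrightarrow> (\<forall>C\<in>\<C>. x \<in> C \<longleftrightarrow> C \<in> \<D>)" if "\<D> \<subseteq> \<C>" for x \<D>
  proof -
    have "F x = e \<D> \<longleftrightarrow> {C \<in> \<C>. x \<in> C} = \<D>"
      unfolding F_def using that by (intro inj_on_eq_iff[OF e]) auto
    then show ?thesis using that by auto
  qed
  have "continuous_map (str_top P) (discrete_topology (e ` Pow \<C>)) F"
  proof (rule continuous_map_to_discrete_topology)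
    show "F \<in> univ P \<rightarrow> e ` Pow \<C>" by (auto simp: F_def)
    fix y assume "y \<in> e ` Pow \<C>"
    then obtain \<D> where \<D>: "\<D> \<subseteq> \<C>" "y = e \<D>" by blast
    have "openin (str_top P) {x \<in> univ P. \<forall>C\<in>\<C>. x \<in> C \<longleftrightarrow> C \<in> \<D>}"
    proof (rule openin_finite_Ball[OF \<C>(1)])
      fix C assume "C \<in> \<C>"
      then have C: "C \<in> clopens (str_top P)" using \<C>(2) by blast
      have "{x \<in> univ P. x \<in> C \<longleftrightarrow> C \<in> \<D>} = (if C \<in> \<D> then C else univ P - C)"
        using clopens_subset[OF C] by auto
      then show "openin (str_top P) {x \<in> univ P. x \<in> C \<longleftrightarrow> C \<in> \<D>}"
        using C clopens_diff[OF C] by (simp add: clopens_def)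
    qed
    then show "openin (str_top P) {x \<in> univ P. F x = y}" by (simp add: \<D> F_eq)
  qed
  then obtain A \<phi> f0 where A: "A \<in> \<G>" "epimorphism L P A \<phi>" "\<forall>x\<in>univ P. F x = f0 (\<phi> x)"
    using lim \<C>(1) unfolding projective_Fraisse_limit_def by (metis finite_Pow_iff finite_imageI)
  show thesis
  proof (rule that[OF A(1,2)])
    fix C x y assume C: "C \<in> \<C>" and "x \<in> univ P" "y \<in> univ P" "\<phi> x = \<phi> y"
    then have "F x = e {C \<in> \<C>. y \<in> C}" using A(3) by (metis F_def)
    with C show "x \<in> C \<longleftrightarrow> y \<in> C" by (subst (asm) F_eq) auto
  qed
qed

lemma limit_epimorphism_homogeneous:
  assumes lim: "projective_Fraisse_limit L \<G> P"
    and "A \<in> \<G>" "epimorphism L P A \<phi>" "epimorphism L P A \<phi>'"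
  obtains g where "g \<in> Aut L P" "\<And>x. x \<in> univ P \<Longrightarrow> \<phi>' x = \<phi> (g x)"
proof -
  obtain \<psi> where \<psi>: "struct_iso L P P \<psi>" "\<forall>x\<in>univ P. \<phi>' x = \<phi> (\<psi> x)"
    using assms unfolding projective_Fraisse_limit_def by metis
  have "topological_structure L P" using lim by (simp add: projective_Fraisse_limit_def)
  from restrict_in_Aut[OF this \<psi>(1)] \<psi>(2) show thesis by (intro that[of "restrict \<psi> (univ P)"]) simp_all
qed

text \<open>The base property of the sets \<open>[\<phi>, S]\<close>, with targets taken from the
  representatives \<open>\<G>0\<close> only; this restriction makes countably many conditions
  suffice later.\<close>

lemma Aut_nbhd_graph_image:
  assumes lim: "projective_Fraisse_limit L \<G> P"
    and fin: "\<And>A. A \<in> \<G> \<Longrightarrow> topological_structure L A"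
    and rep: "\<G>0 \<subseteq> \<G>" "\<And>A. A \<in> \<G> \<Longrightarrow> \<exists>B\<in>\<G>0. \<exists>\<phi>. struct_iso L B A \<phi>"
    and U: "openin (Aut_topology L P) U" "h \<in> U" "h \<in> Aut L P"
  obtains A \<phi> where "A \<in> \<G>0" "epimorphism L P A \<phi>"
    "\<And>g. g \<in> Aut L P \<Longrightarrow> graph_image P \<phi> g = graph_image P \<phi> h \<Longrightarrow> g \<in> U"
proof -
  have P: "topological_structure L P" using lim by (simp add: projective_Fraisse_limit_def)
  show thesis
  proof (rule Aut_clopen_nbhd[OF P U(1,2)])
    fix \<C> assume \<C>: "finite \<C>" "\<C> \<subseteq> clopens (str_top P)"
      "\<And>g. g \<in> Aut L P \<Longrightarrow> (\<And>C x. C \<in> \<C> \<Longrightarrow> x \<in> univ P \<Longrightarrow> g x \<in> C \<longleftrightarrow> h x \<in> C) \<Longrightarrow> g \<in> U"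
    \<comment> \<open>\<open>V C\<close> is the preimage of \<open>C\<close> under \<open>h\<close>.
      Refining these sets too guarantees that points with the same class have images under
      \<open>h\<close> in the same members of \<open>\<C>\<close>.\<close>
    define V where "V C = {x \<in> univ P. h x \<in> C}" for C
    have fin': "finite (\<C> \<union> V ` \<C>)" using \<C>(1) by simp
    have sub: "\<C> \<union> V ` \<C> \<subseteq> clopens (str_top P)"
      using \<C>(2) clopens_preimage[OF Aut_continuous[OF U(3)]] by (auto simp: V_def)
    show thesis
    proof (rule limit_epimorphism_refines[OF lim fin' sub])
      fix A \<phi> assume A: "A \<in> \<G>" "epimorphism L P A \<phi>"
        and refine: "\<And>C x y. C \<in> \<C> \<union> V ` \<C> \<Longrightarrow> x \<in> univ P \<Longrightarrow> y \<in> univ P \<Longrightarrow> \<phi> x = \<phi> y \<Longrightarrow> x \<in> C \<longleftrightarrow> y \<in> C"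
      obtain B \<rho> where B: "B \<in> \<G>0" "struct_iso L B A \<rho>" using rep(2)[OF A(1)] by blast
      have tA: "topological_structure L A" and tB: "topological_structure L B" using fin A(1) B(1) rep(1) by auto
      have iso: "struct_iso L A B (inv_into (univ B) \<rho>)" by (rule struct_iso_inverse[OF tB tA B(2)])
      show thesis
      proof (rule that[OF B(1)])
        show "epimorphism L P B (inv_into (univ B) \<rho> \<circ> \<phi>)"
          using A(2) iso by (intro epimorphism_compose[OF tA]) (simp_all add: struct_iso_def)
        fix g assume g: "g \<in> Aut L P"
          "graph_image P (inv_into (univ B) \<rho> \<circ> \<phi>) g = graph_image P (inv_into (univ B) \<rho> \<circ> \<phi>) h"
        have inv: "\<phi> x = \<phi> y" if "inv_into (univ B) \<rho> (\<phi> x) = inv_into (univ B) \<rho> (\<phi> y)" "x \<in> univ P" "y \<in> univ P" for x y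
          using that epimorphism_in_univ[OF A(2)] iso by (auto simp: struct_iso_def bij_betw_def inj_on_def)
        show "g \<in> U"
        proof (rule \<C>(3)[OF g(1)])
          fix C x assume C: "C \<in> \<C>" and x: "x \<in> univ P"
          have gx: "g x \<in> univ P" by (rule Aut_in_univ[OF g(1) x])
          have "((inv_into (univ B) \<rho> \<circ> \<phi>) x, (inv_into (univ B) \<rho> \<circ> \<phi>) (g x)) \<in>
              graph_image P (inv_into (univ B) \<rho> \<circ> \<phi>) h"
            unfolding g(2)[symmetric] using x by (rule imageI)
          \<comment> \<open>Equality of graph images gives only some \<open>z\<close> that shares
            its class with \<open>x\<close> while \<open>h z\<close> shares its class with
            \<open>g x\<close>. Membership in \<open>C\<close> is carried from \<open>g x\<close> to
            \<open>h z\<close> by refinement of \<open>C\<close>, and from \<open>h z\<close> to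
            \<open>h x\<close> by refinement of \<open>V C\<close>.\<close>
          then obtain z where z: "z \<in> univ P"
            "inv_into (univ B) \<rho> (\<phi> x) = inv_into (univ B) \<rho> (\<phi> z)"
            "inv_into (univ B) \<rho> (\<phi> (g x)) = inv_into (univ B) \<rho> (\<phi> (h z))" by auto
          have hz: "h z \<in> univ P" by (rule Aut_in_univ[OF U(3) z(1)])
          have "g x \<in> C \<longleftrightarrow> h z \<in> C"
            using C by (intro refine gx hz inv[OF z(3) gx hz]) simp
          also have "\<dots> \<longleftrightarrow> z \<in> V C" using z(1) by (simp add: V_def)
          also have "\<dots> \<longleftrightarrow> x \<in> V C"
            using C by (intro refine z(1) x inv[OF z(2) x z(1), symmetric]) simp
          also have "\<dots> \<longleftrightarrow> h x \<in> C" using x by (simp add: V_def)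
          finally show "g x \<in> C \<longleftrightarrow> h x \<in> C" .
        qed
      qed
    qed
  qed
qed

section \<open>Dense orbits and joint projection\<close>

lemma orbit_conjugation:
  "h \<in> H \<Longrightarrow> orbit (Aut_group L P) (conjugation (Aut_group L P) H) h = {conj_by L P g h | g. g \<in> Aut L P}"
  by (simp add: orbit_def conjugation_def)

lemma JPP_imp_dense_orbit:
  fixes L :: "('f, 'r) language" and \<G> :: "('f, 'r, 'a) struct set" and P :: "('f, 'r, 'p) struct"
  assumes s: "s \<notin> rel_syms L"
    and fin: "\<And>A. A \<in> \<G> \<Longrightarrow> topological_structure L A \<and> finite (univ A)"
    and count: "countable_family L \<G>"
    and lim: "projective_Fraisse_limit L \<G> P"
    and H: "H \<noteq> {}" "closedin (Aut_topology L P) H"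
    and conj: "\<And>g h. g \<in> Aut L P \<Longrightarrow> h \<in> H \<Longrightarrow> conj_by L P g h \<in> H"
    and JPP: "JPP (add_binary L s) (induced_family L s \<G> P H)"
  shows "\<exists>h\<in>H. subtopology (Aut_topology L P) H closure_of
    orbit (Aut_group L P) (conjugation (Aut_group L P) H) h = H"
proof -
  have P: "topological_structure L P" using lim by (simp add: projective_Fraisse_limit_def)
  let ?X = "subtopology (Aut_topology L P) H"
  have HA: "H \<subseteq> Aut L P" using closedin_subset[OF H(2)] topspace_Aut_topology[OF P] by simp
  have topX: "topspace ?X = H" using closedin_subset[OF H(2)] by (simp add: inf.absorb2)
  obtain \<G>0 where \<G>0: "\<G>0 \<subseteq> \<G>" "countable \<G>0" "\<And>A. A \<in> \<G> \<Longrightarrow> \<exists>B\<in>\<G>0. \<exists>\<phi>. struct_iso L B A \<phi>"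
    using count unfolding countable_family_def by metis
  have top: "topological_structure L A" and finA: "finite (univ A)" if "A \<in> \<G>" for A
    using fin[OF that] by simp_all
  \<comment> \<open>\<open>D A S\<close> is the union of all \<open>[\<phi>, S]\<close> with target
    \<open>A\<close>; leaving \<open>\<phi>\<close> free makes it invariant under
    conjugation.\<close>
  define D where "D A S = {k \<in> H. \<exists>\<phi>. epimorphism L P A \<phi> \<and> graph_image P \<phi> k = S}" for A :: "('f, 'r, 'a) struct" and S
  define I where "I = (SIGMA A:\<G>0. Pow (univ A \<times> univ A))"
  define \<D> where "\<D> = {T. \<exists>p\<in>I. T = D (fst p) (snd p) \<and> T \<noteq> {}}"
  have "countable I"
    unfolding I_def using \<G>0(1,2) finA
    by (intro countable_SIGMA) (auto intro!: countable_finite)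
  then have "countable \<D>"
    by (rule countable_subset[OF _ countable_image[of I "\<lambda>p. D (fst p) (snd p)"], rotated]) (auto simp: \<D>_def)
  have D_conj: "conj_by L P g k \<in> D A S" if k: "k \<in> D A S" and g: "g \<in> Aut L P" and A: "A \<in> \<G>" for g k A S
  proof -
    obtain \<phi> where \<phi>: "epimorphism L P A \<phi>" "graph_image P \<phi> k = S" and kH: "k \<in> H"
      using k by (auto simp: D_def)
    have "struct_iso L P P g" using g by (simp add: Aut_def)
    then have "epimorphism L P P (inv_into (univ P) g)"
      using struct_iso_inverse[OF P P] by (simp add: struct_iso_def)
    \<comment> \<open>Composing with the inverse of \<open>g\<close> undoes the conjugation, so the
      conjugate has the same graph image as \<open>k\<close> under another epimorphism onto
      \<open>A\<close>.\<close>
    then have \<phi>': "epimorphism L P A (\<phi> \<circ> inv_into (univ P) g)"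
      using \<phi>(1) by (rule epimorphism_compose[OF P])
    have kA: "k \<in> Aut L P" using kH HA by blast
    have inv: "inv_into (univ P) g (g x) = x" if "x \<in> univ P" for x
      using Aut_bij_betw[OF g] that by (simp add: bij_betw_def)
    have "graph_image P (\<phi> \<circ> inv_into (univ P) g) (conj_by L P g k) = graph_image P \<phi> k"
      unfolding graph_image_conj_by[OF P g kA] using inv Aut_in_univ[OF kA] by (simp cong: image_cong)
    then have "graph_image P (\<phi> \<circ> inv_into (univ P) g) (conj_by L P g k) = S"
      using \<phi>(2) by (rule trans)
    then show ?thesis
      unfolding D_def by (intro CollectI conjI exI) (rule conj[OF g kH] \<phi>' | assumption)+
  qed
  have dense: "openin ?X T \<and> ?X closure_of T = topspace ?X" if T: "T \<in> \<D>" for T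
  proof
    obtain A S where A: "A \<in> \<G>0" "T = D A S" "D A S \<noteq> {}"
      using T by (auto simp: \<D>_def I_def)
    have AG: "A \<in> \<G>" using A(1) \<G>0(1) by blast
    have "D A S = H \<inter> \<Union>{{k \<in> Aut L P. graph_image P \<phi> k = S} | \<phi>. epimorphism L P A \<phi>}"
      using HA by (auto simp: D_def)
    moreover have "openin (Aut_topology L P) (\<Union>{{k \<in> Aut L P. graph_image P \<phi> k = S} | \<phi>. epimorphism L P A \<phi>})"
      using openin_Aut_graph_image_eq[OF P top[OF AG] finA[OF AG]] by (intro openin_Union) blast
    ultimately show "openin ?X T"
      unfolding A(2) by (simp add: openin_subtopology_Int2)
    obtain k0 \<phi>0 where k0: "k0 \<in> H" "epimorphism L P A \<phi>0" "graph_image P \<phi>0 k0 = S"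
      using A(3) by (auto simp: D_def)
    show "?X closure_of T = topspace ?X"
      unfolding dense_intersects_open
    proof (intro allI impI, elim conjE)
      fix U assume U: "openin ?X U" "U \<noteq> {}"
      then obtain V where V: "openin (Aut_topology L P) V" "U = V \<inter> H" by (auto simp: openin_subtopology)
      obtain k where k: "k \<in> V" "k \<in> H" using U(2) V(2) by blast
      have kA: "k \<in> Aut L P" using k(2) HA by blast
      show "T \<inter> U \<noteq> {}"
      proof (rule Aut_nbhd_graph_image[OF lim top \<G>0(1,3) V(1) k(1) kA])
        fix B \<phi> assume B: "B \<in> \<G>0" "epimorphism L P B \<phi>"
          and nbhd: "\<And>g. g \<in> Aut L P \<Longrightarrow> graph_image P \<phi> g = graph_image P \<phi> k \<Longrightarrow> g \<in> V"
        have BG: "B \<in> \<G>" using B(1) \<G>0(1) by blast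
        have "expand s A S \<in> induced_family L s \<G> P H"
          unfolding induced_family_eq[OF s HA] using k0 AG by blast
        moreover have "expand s B (graph_image P \<phi> k) \<in> induced_family L s \<G> P H"
          unfolding induced_family_eq[OF s HA] using k(2) B(2) BG by blast
        ultimately obtain E \<alpha> \<beta> where E: "E \<in> induced_family L s \<G> P H"
          "epimorphism (add_binary L s) E (expand s A S) \<alpha>"
          "epimorphism (add_binary L s) E (expand s B (graph_image P \<phi> k)) \<beta>"
          using JPP unfolding JPP_def by blast
        obtain C \<theta> f where C: "E = expand s C (graph_image P \<theta> f)" "C \<in> \<G>" "epimorphism L P C \<theta>" "f \<in> H"
          using E(1) unfolding induced_family_eq[OF s HA] by blast
        have fA: "f \<in> Aut L P" using C(4) HA by blast
        have "S \<subseteq> univ A \<times> univ A"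
          unfolding k0(3)[symmetric] using k0(1) HA by (intro graph_image_subset[OF k0(2)]) blast
        from E(2)[unfolded C(1) epimorphism_expand[OF s graph_image_subset[OF C(3) fA] this]]
        have \<alpha>: "epimorphism L C A \<alpha>" "graph_image P (\<alpha> \<circ> \<theta>) f = S"
          unfolding map_prod_graph_image by simp_all
        from E(3)[unfolded C(1) epimorphism_expand[OF s graph_image_subset[OF C(3) fA] graph_image_subset[OF B(2) kA]]]
        have \<beta>: "epimorphism L C B \<beta>" "graph_image P (\<beta> \<circ> \<theta>) f = graph_image P \<phi> k"
          unfolding map_prod_graph_image by simp_all
        \<comment> \<open>Now \<open>\<beta> \<circ> \<theta>\<close> and \<open>\<phi>\<close> both
          map \<open>P\<close> onto \<open>B\<close>. Homogeneity yields \<open>g\<close> relating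
          them, and conjugating \<open>f\<close> by \<open>g\<close> gives it the graph image of
          \<open>k\<close> under \<open>\<phi>\<close>, hence puts it into \<open>V\<close>.\<close>
        have "epimorphism L P B (\<beta> \<circ> \<theta>)" using C(3) \<beta>(1) by (rule epimorphism_compose[OF top[OF C(2)]])
        from limit_epimorphism_homogeneous[OF lim BG B(2) this]
        obtain g where g: "g \<in> Aut L P" "\<And>x. x \<in> univ P \<Longrightarrow> (\<beta> \<circ> \<theta>) x = \<phi> (g x)" by metis
        have "graph_image P \<phi> (conj_by L P g f) = graph_image P (\<beta> \<circ> \<theta>) f"
          unfolding graph_image_conj_by[OF P g(1) fA]
          using g(2) Aut_in_univ[OF fA] by (intro image_cong) simp_all
        then have "conj_by L P g f \<in> V" using nbhd conj_by_Aut(1)[OF P g(1) fA] \<beta>(2) by simp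
        moreover have "f \<in> D A S"
          using C(4) \<alpha>(2) epimorphism_compose[OF top[OF C(2)] C(3) \<alpha>(1)] unfolding D_def by blast
        \<comment> \<open>The element \<open>f\<close> was in \<open>D A S\<close> before
          conjugation, through \<open>\<alpha> \<circ> \<theta>\<close>; invariance keeps its
          conjugate there.\<close>
        then have "conj_by L P g f \<in> D A S" using D_conj g(1) AG by blast
        moreover have "conj_by L P g f \<in> H" using conj g(1) C(4) by blast
        ultimately show ?thesis unfolding A(2) V(2) by blast
      qed
    qed
  qed
  have "completely_metrizable_space ?X"
    using completely_metrizable_Aut_topology[OF P] H(2) by (rule completely_metrizable_space_closedin)
  then have "?X closure_of \<Inter>\<D> = H"
    using Baire_category[of ?X \<D>] \<open>countable \<D>\<close> dense unfolding topX by blast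
  \<comment> \<open>Since \<open>H\<close> is nonempty, density yields a point of the intersection;
    any such point will have a dense orbit.\<close>
  then obtain h0 where "h0 \<in> ?X closure_of \<Inter>\<D>" using H(1) by blast
  then obtain h where h: "h \<in> \<Inter>\<D>" "h \<in> H"
    unfolding in_closure_of using openin_topspace[of ?X] topX by metis
  have hA: "h \<in> Aut L P" using h(2) HA by blast
  have "?X closure_of {conj_by L P g h | g. g \<in> Aut L P} = topspace ?X"
    unfolding dense_intersects_open
  proof (intro allI impI, elim conjE)
    fix U assume U: "openin ?X U" "U \<noteq> {}"
    then obtain V where V: "openin (Aut_topology L P) V" "U = V \<inter> H" by (auto simp: openin_subtopology)
    obtain k where k: "k \<in> V" "k \<in> H" using U(2) V(2) by blast
    have kA: "k \<in> Aut L P" using k(2) HA by blast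
    show "{conj_by L P g h | g. g \<in> Aut L P} \<inter> U \<noteq> {}"
    proof (rule Aut_nbhd_graph_image[OF lim top \<G>0(1,3) V(1) k(1) kA])
      fix B \<phi> assume B: "B \<in> \<G>0" "epimorphism L P B \<phi>"
        and nbhd: "\<And>g. g \<in> Aut L P \<Longrightarrow> graph_image P \<phi> g = graph_image P \<phi> k \<Longrightarrow> g \<in> V"
      have BG: "B \<in> \<G>" using B(1) \<G>0(1) by blast
      \<comment> \<open>The element \<open>k\<close> itself witnesses that this set is nonempty, so
        it is one of the dense sets and contains \<open>h\<close>. Some epimorphism thus gives
        \<open>h\<close> the graph image of \<open>k\<close>, and homogeneity turns it into
        \<open>\<phi>\<close> composed with an automorphism.\<close>
      have "k \<in> D B (graph_image P \<phi> k)" using k(2) B(2) unfolding D_def by blast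
      moreover have "(B, graph_image P \<phi> k) \<in> I"
        using B(1) graph_image_subset[OF B(2) kA] by (simp add: I_def)
      ultimately have "D B (graph_image P \<phi> k) \<in> \<D>" unfolding \<D>_def by force
      then have "h \<in> D B (graph_image P \<phi> k)" using h(1) by blast
      then obtain \<phi>' where \<phi>': "epimorphism L P B \<phi>'" "graph_image P \<phi>' h = graph_image P \<phi> k"
        unfolding D_def by blast
      from limit_epimorphism_homogeneous[OF lim BG B(2) \<phi>'(1)]
      obtain g where g: "g \<in> Aut L P" "\<And>x. x \<in> univ P \<Longrightarrow> \<phi>' x = \<phi> (g x)" by metis
      have "graph_image P \<phi> (conj_by L P g h) = graph_image P \<phi>' h"
        unfolding graph_image_conj_by[OF P g(1) hA]
        using g(2) Aut_in_univ[OF hA] by (intro image_cong) simp_all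
      then have "conj_by L P g h \<in> V" using nbhd conj_by_Aut(1)[OF P g(1) hA] \<phi>'(2) by simp
      moreover have "conj_by L P g h \<in> H" using conj g(1) h(2) by blast
      ultimately show ?thesis using g(1) V(2) by blast
    qed
  qed
  then show ?thesis using h(2) unfolding topX by (intro bexI[of _ h]) (simp_all add: orbit_conjugation)
qed

lemma dense_orbit_imp_JPP:
  fixes L :: "('f, 'r) language" and \<G> :: "('f, 'r, 'a) struct set" and P :: "('f, 'r, 'p) struct"
  assumes s: "s \<notin> rel_syms L"
    and fin: "\<And>A. A \<in> \<G> \<Longrightarrow> topological_structure L A \<and> finite (univ A)"
    and lim: "projective_Fraisse_limit L \<G> P"
    and HA: "H \<subseteq> Aut L P" and h: "h \<in> H"
    and dense: "subtopology (Aut_topology L P) H closure_of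
      orbit (Aut_group L P) (conjugation (Aut_group L P) H) h = H"
  shows "JPP (add_binary L s) (induced_family L s \<G> P H)"
  unfolding JPP_def
proof (intro ballI)
  have P: "topological_structure L P" using lim by (simp add: projective_Fraisse_limit_def)
  have top: "topological_structure L A" and finA: "finite (univ A)" if "A \<in> \<G>" for A
    using fin[OF that] by simp_all
  have hA: "h \<in> Aut L P" using h HA by blast
  \<comment> \<open>The set \<open>[\<phi>, S]\<close> around \<open>f\<close> is open in
    \<open>H\<close>, so it contains a conjugate of \<open>h\<close>. The conjugating
    \<open>g\<close> is absorbed into the epimorphism, and \<open>\<phi> \<circ> g\<close> realizes
    the structure using \<open>h\<close> instead of \<open>f\<close>.\<close>
  have lift: "\<exists>\<psi>. epimorphism L P A \<psi> \<and> graph_image P \<psi> h = graph_image P \<phi> f"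
    if A: "A \<in> \<G>" "epimorphism L P A \<phi>" and f: "f \<in> H" for A \<phi> f
  proof -
    define U where "U = {k \<in> Aut L P. graph_image P \<phi> k = graph_image P \<phi> f} \<inter> H"
    have "f \<in> U \<and> openin (subtopology (Aut_topology L P) H) U"
      using f HA openin_Aut_graph_image_eq[OF P top[OF A(1)] finA[OF A(1)] A(2)]
      by (auto simp: U_def intro: openin_subtopology_Int)
    moreover have "f \<in> subtopology (Aut_topology L P) H closure_of
      orbit (Aut_group L P) (conjugation (Aut_group L P) H) h" using dense f by simp
    ultimately obtain k where "k \<in> orbit (Aut_group L P) (conjugation (Aut_group L P) H) h" "k \<in> U"
      unfolding in_closure_of by metis
    then obtain g where g: "g \<in> Aut L P" "conj_by L P g h \<in> U"
      unfolding orbit_conjugation[OF h] by blast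
    then have "graph_image P (\<phi> \<circ> g) h = graph_image P \<phi> f"
      unfolding graph_image_conj_by[OF P g(1) hA, symmetric] by (simp add: U_def)
    moreover have "epimorphism L P A (\<phi> \<circ> g)"
      using Aut_epimorphism[OF g(1)] A(2) by (rule epimorphism_compose[OF P])
    ultimately show ?thesis by blast
  qed
  fix E1 E2 assume "E1 \<in> induced_family L s \<G> P H" and "E2 \<in> induced_family L s \<G> P H"
  then obtain A \<phi>1 f B \<phi>2 g where
    A: "E1 = expand s A (graph_image P \<phi>1 f)" "A \<in> \<G>" "epimorphism L P A \<phi>1" "f \<in> H" and
    B: "E2 = expand s B (graph_image P \<phi>2 g)" "B \<in> \<G>" "epimorphism L P B \<phi>2" "g \<in> H"
    unfolding induced_family_eq[OF s HA] by blast
  obtain \<psi>1 where \<psi>1: "epimorphism L P A \<psi>1" "graph_image P \<psi>1 h = graph_image P \<phi>1 f"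
    using lift[OF A(2-4)] by blast
  obtain \<psi>2 where \<psi>2: "epimorphism L P B \<psi>2" "graph_image P \<psi>2 h = graph_image P \<phi>2 g"
    using lift[OF B(2-4)] by blast
  \<comment> \<open>A finite quotient that refines the fibres of \<open>\<psi>1\<close> and
    \<open>\<psi>2\<close> lets both maps factor through it; expanded by the image of the graph of
    \<open>h\<close>, it is the joint projection sought.\<close>
  define fib1 where "fib1 a = {x \<in> univ P. \<psi>1 x = a}" for a
  define fib2 where "fib2 a = {x \<in> univ P. \<psi>2 x = a}" for a
  have fin\<C>: "finite (fib1 ` univ A \<union> fib2 ` univ B)" using finA A(2) B(2) by simp
  have sub: "fib1 ` univ A \<union> fib2 ` univ B \<subseteq> clopens (str_top P)"
    using clopens_fibre[OF top[OF A(2)] finA[OF A(2)] \<psi>1(1)] clopens_fibre[OF top[OF B(2)] finA[OF B(2)] \<psi>2(1)]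
    by (auto simp: fib1_def fib2_def)
  show "\<exists>E\<in>induced_family L s \<G> P H. (\<exists>\<phi>. epimorphism (add_binary L s) E E1 \<phi>) \<and>
    (\<exists>\<psi>. epimorphism (add_binary L s) E E2 \<psi>)"
  proof (rule limit_epimorphism_refines[OF lim fin\<C> sub])
    fix C \<theta> assume C: "C \<in> \<G>" "epimorphism L P C \<theta>" and
      refine: "\<And>D x y. D \<in> fib1 ` univ A \<union> fib2 ` univ B \<Longrightarrow> x \<in> univ P \<Longrightarrow> y \<in> univ P \<Longrightarrow>
        \<theta> x = \<theta> y \<Longrightarrow> x \<in> D \<longleftrightarrow> y \<in> D"
    have factor: "\<exists>\<alpha>. epimorphism (add_binary L s) (expand s C (graph_image P \<theta> h))
        (expand s A' (graph_image P \<psi> h)) \<alpha>"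
      if A': "A' \<in> \<G>" "epimorphism L P A' \<psi>"
        and eq: "\<And>x y. x \<in> univ P \<Longrightarrow> y \<in> univ P \<Longrightarrow> \<theta> x = \<theta> y \<Longrightarrow> \<psi> x = \<psi> y" for A' \<psi>
    proof -
      \<comment> \<open>The choice of preimages is immaterial, as \<open>\<psi>\<close> is constant
        on the fibres of \<open>\<theta>\<close>; continuity is automatic on the finite discrete
        space \<open>C\<close>.\<close>
      define \<alpha> where "\<alpha> = \<psi> \<circ> inv_into (univ P) \<theta>"
      have inv: "inv_into (univ P) \<theta> c \<in> univ P" "\<theta> (inv_into (univ P) \<theta> c) = c" if "c \<in> univ C" for c
        using that epimorphism_image[OF C(2)] by (simp_all add: inv_into_into f_inv_into_f)
      have \<alpha>\<theta>: "\<alpha> (\<theta> x) = \<psi> x" if "x \<in> univ P" for x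
        unfolding \<alpha>_def comp_def using inv[OF epimorphism_in_univ[OF C(2) that]] that by (intro eq)
      have "continuous_map (str_top C) (str_top A') \<alpha>"
        by (subst finite_structure_discrete[OF top[OF C(1)] finA[OF C(1)]])
          (auto simp: \<alpha>_def inv(1) epimorphism_in_univ[OF A'(2)])
      then have "epimorphism L C A' \<alpha>" using \<alpha>\<theta> by (rule epimorphism_factor[OF P C(2) A'(2)])
      moreover have "map_prod \<alpha> \<alpha> ` graph_image P \<theta> h = graph_image P \<psi> h"
        unfolding map_prod_graph_image using \<alpha>\<theta> Aut_in_univ[OF hA] by (intro image_cong) simp_all
      ultimately show ?thesis
        unfolding epimorphism_expand[OF s graph_image_subset[OF C(2) hA] graph_image_subset[OF A'(2) hA]]
        by blast
    qed
    have eq1: "\<psi>1 x = \<psi>1 y" if "x \<in> univ P" "y \<in> univ P" "\<theta> x = \<theta> y" for x y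
      using refine[OF UnI1[OF imageI[OF epimorphism_in_univ[OF \<psi>1(1) that(1)]]] that] that by (simp add: fib1_def)
    have eq2: "\<psi>2 x = \<psi>2 y" if "x \<in> univ P" "y \<in> univ P" "\<theta> x = \<theta> y" for x y
      using refine[OF UnI2[OF imageI[OF epimorphism_in_univ[OF \<psi>2(1) that(1)]]] that] that by (simp add: fib2_def)
    have "expand s C (graph_image P \<theta> h) \<in> induced_family L s \<G> P H"
      unfolding induced_family_eq[OF s HA] using C h by blast
    moreover have "\<exists>\<alpha>. epimorphism (add_binary L s) (expand s C (graph_image P \<theta> h)) E1 \<alpha>"
      using factor[OF A(2) \<psi>1(1) eq1] unfolding A(1) \<psi>1(2) .
    moreover have "\<exists>\<alpha>. epimorphism (add_binary L s) (expand s C (graph_image P \<theta> h)) E2 \<alpha>"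
      using factor[OF B(2) \<psi>2(1) eq2] unfolding B(1) \<psi>2(2) .
    ultimately show ?thesis by blast
  qed
qed

theorem theoremA1:
  fixes L0 :: "('f, 'r) language"
    and s :: 'r
    and \<G> :: "('f, 'r, 'a) struct set"
    and P :: "('f, 'r, 'p) struct"
    and H :: "('p \<Rightarrow> 'p) set"
  assumes "s \<notin> rel_syms L0"
    and "projective_Fraisse_family L0 \<G>"
    and "countable_family L0 \<G>"
    and "projective_Fraisse_limit L0 \<G> P"
    and "H \<noteq> {}"
    and "closedin (Aut_topology L0 P) H"
    and "\<forall>g\<in>Aut L0 P. \<forall>h\<in>H.
           g \<otimes>\<^bsub>Aut_group L0 P\<^esub> h \<otimes>\<^bsub>Aut_group L0 P\<^esub> inv\<^bsub>Aut_group L0 P\<^esub> g \<in> H"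
  shows "JPP (add_binary L0 s) (induced_family L0 s \<G> P H) \<longleftrightarrow>
         (\<exists>h\<in>H. subtopology (Aut_topology L0 P) H closure_of
                  orbit (Aut_group L0 P) (conjugation (Aut_group L0 P) H) h = H)"
proof
  have fin: "topological_structure L0 A \<and> finite (univ A)" if "A \<in> \<G>" for A
    using assms(2) that by (simp add: projective_Fraisse_family_def)
  have P: "topological_structure L0 P" using assms(4) by (simp add: projective_Fraisse_limit_def)
  have HA: "H \<subseteq> Aut L0 P" using closedin_subset[OF assms(6)] topspace_Aut_topology[OF P] by simp
  show "\<exists>h\<in>H. subtopology (Aut_topology L0 P) H closure_of
      orbit (Aut_group L0 P) (conjugation (Aut_group L0 P) H) h = H"
    if "JPP (add_binary L0 s) (induced_family L0 s \<G> P H)"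
    using assms(7) by (intro JPP_imp_dense_orbit[OF assms(1) fin assms(3-6) _ that]) simp_all
  show "JPP (add_binary L0 s) (induced_family L0 s \<G> P H)"
    if "\<exists>h\<in>H. subtopology (Aut_topology L0 P) H closure_of
      orbit (Aut_group L0 P) (conjugation (Aut_group L0 P) H) h = H"
    using that by (elim bexE) (rule dense_orbit_imp_JPP[OF assms(1) fin assms(4) HA])
qed

end
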